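(* There exists $\alpha_0>0$ such that for every even integer $\alpha\ge\alpha_0$ the velocity field $u_\alpha$ is an exponential mixer: there exist constants $C,c>0$ (depending on $\alpha$) such that for all $f,g\in C^1(\mathbb{T}^2)$ and all $t\ge0$, $$\left|\int_{\mathbb{T}^2}(f\circ\phi_t^{-1})\,g\,dz-\int_{\mathbb{T}^2}f\,dz\int_{\mathbb{T}^2}g\,dz\right|\le C e^{-ct}\,\|f\|_{C^1}\|g\|_{C^1},$$ where $\phi_t$ is the flow map of $u_\alpha$.
   Context: $\mathbb{T}^2=\mathbb{R}^2/\mathbb{Z}^2$ with Lebesgue measure of total mass one, and points are written $(x,y)$ with $x,y\in[0,1]$ (endpoints identified). For $\alpha>0$ set $$H_\alpha(x,y)=\begin{pmatrix}-2\alpha|y-1/2|\\0\end{pmatrix},\qquad V_\alpha(x,y)=\begin{pmatrix}0\\-2\alpha|x-1/2|\end{pmatrix}.$$ The velocity field $u_\alpha:[0,\infty)\times\mathbb{T}^2\to\mathbb{R}^2$ is $u_\alpha(t,\cdot)=V_\alpha$ for $t\in[0,1/2)$, $u_\alpha(t,\cdot)=H_\alpha$ for $t\in[1/2,1)$, extended to $t\ge1$ periodically in time with period $1$. The flow map $\phi_t:\mathbb{T}^2\to\mathbb{T}^2$ solves $\frac{d}{dt}\phi_t(z)=u_\alpha(t,\phi_t(z))$, $\phi_0(z)=z$; it is a Lebesgue-measure-preserving homeomorphism for each $t\ge0$. *)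

theory Defs
  imports "HOL-Analysis.Analysis"
begin

quotient_type torus = "real \<times> real" /
  "\<lambda>p q. fst p - fst q \<in> \<int> \<and> snd p - snd q \<in> \<int>"
  morphisms rep_torus proj
proof (rule equivpI)
  show "reflp (\<lambda>p q :: real \<times> real. fst p - fst q \<in> \<int> \<and> snd p - snd q \<in> \<int>)"
    by (simp add: reflp_def)
  show "symp (\<lambda>p q :: real \<times> real. fst p - fst q \<in> \<int> \<and> snd p - snd q \<in> \<int>)"
    by (auto simp: symp_def) (metis Ints_minus minus_diff_eq)+
  show "transp (\<lambda>p q :: real \<times> real. fst p - fst q \<in> \<int> \<and> snd p - snd q \<in> \<int>)"
  proof (rule transpI, goal_cases)
    case (1 p q r)
    have "fst p - fst r = (fst p - fst q) + (fst q - fst r)"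
      "snd p - snd r = (snd p - snd q) + (snd q - snd r)" by simp_all
    with 1 show ?case by (metis Ints_add)
  qed
qed

lemma proj_eq_iff: "proj p = proj q \<longleftrightarrow> fst p - fst q \<in> \<int> \<and> snd p - snd q \<in> \<int>"
  by (rule torus.abs_eq_iff)

instantiation torus :: topological_space
begin

definition open_torus :: "torus set \<Rightarrow> bool" where
  "open_torus U \<longleftrightarrow> open (proj -` U)"

instance
  by standard (auto simp: open_torus_def vimage_Union)

end

lemma continuous_on_proj: "continuous_on UNIV proj"
  by (simp add: continuous_on_open_vimage open_torus_def)

definition torus_measure :: "torus measure" where
  "torus_measure = distr (restrict_space lborel ({0..<1} \<times> {0..<1})) borel proj"

lemma emeasure_torus_measure_UNIV: "emeasure torus_measure UNIV = 1"
proof -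
  have sq: "{0..<1::real} \<times> {0..<1::real} \<in> sets lborel"
    unfolding lborel_prod[symmetric] by (intro pair_measureI) auto
  have "proj \<in> borel_measurable (restrict_space lborel ({0..<1} \<times> {0..<1}))"
    by (intro measurable_restrict_space1) (simp add: continuous_on_proj borel_measurable_continuous_onI)
  then have "emeasure torus_measure UNIV = emeasure lborel ({0..<1::real} \<times> {0..<1::real})"
    using sq by (simp add: torus_measure_def emeasure_distr space_restrict_space emeasure_restrict_space)
  also have "\<dots> = 1"
    unfolding lborel_prod[symmetric] by (subst lborel.emeasure_pair_measure_Times) auto
  finally show ?thesis .
qed

text \<open>Derivatives on the torus are those of the periodic lift to the plane. The operator norm of
  the derivative of a real-valued function is the Euclidean norm of its gradient.\<close>

definition C1_torus :: "(torus \<Rightarrow> real) \<Rightarrow> bool" where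
  "C1_torus f \<longleftrightarrow> (\<forall>p. (f \<circ> proj) differentiable at p) \<and>
     (\<forall>v. continuous_on UNIV (\<lambda>p. frechet_derivative (f \<circ> proj) (at p) v))"

definition C1_norm :: "(torus \<Rightarrow> real) \<Rightarrow> real" where
  "C1_norm f = (SUP z. \<bar>f z\<bar>) + (SUP p. onorm (frechet_derivative (f \<circ> proj) (at p)))"

lemma frac_cong: "x - y \<in> \<int> \<Longrightarrow> frac x = frac (y :: real)"
proof -
  assume "x - y \<in> \<int>"
  then obtain n where "x = y + of_int n" by (elim Ints_cases) (auto simp: algebra_simps)
  then show ?thesis by (simp add: frac_def)
qed

text \<open>The profile \<^term>\<open>\<bar>frac x - 1/2\<bar>\<close> is the periodic extension of
  \<^term>\<open>\<bar>x - 1/2\<bar>\<close> from the unit interval, whose endpoints give the same value.\<close>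

lift_definition H_field :: "real \<Rightarrow> torus \<Rightarrow> real \<times> real" is
  "\<lambda>\<alpha> p. (- 2 * \<alpha> * \<bar>frac (snd p) - 1/2\<bar>, 0)"
  by (auto dest: frac_cong)

lift_definition V_field :: "real \<Rightarrow> torus \<Rightarrow> real \<times> real" is
  "\<lambda>\<alpha> p. (0, - 2 * \<alpha> * \<bar>frac (fst p) - 1/2\<bar>)"
  by (auto dest: frac_cong)

definition u_field :: "real \<Rightarrow> real \<Rightarrow> torus \<Rightarrow> real \<times> real" where
  "u_field \<alpha> t = (if frac t < 1/2 then V_field \<alpha> else H_field \<alpha>)"

text \<open>The field jumps in time at half-integers, so trajectories are continuous and satisfy the
  differential equation at all other times. Trajectories on the torus are projections of
  trajectories in the plane.\<close>

definition is_flow_map ::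
    "(real \<Rightarrow> torus \<Rightarrow> real \<times> real) \<Rightarrow> (real \<Rightarrow> torus \<Rightarrow> torus) \<Rightarrow> bool" where
  "is_flow_map u \<phi> \<longleftrightarrow> (\<forall>z. \<phi> 0 z = z \<and>
     (\<exists>\<gamma>. continuous_on {0..} \<gamma> \<and> (\<forall>t\<ge>0. \<phi> t z = proj (\<gamma> t)) \<and>
          (\<forall>t>0. 2 * t \<notin> \<int> \<longrightarrow> (\<gamma> has_vector_derivative u t (\<phi> t z)) (at t))))"

lemma fst_V_field: "fst (V_field \<alpha> z) = 0"
  by (induct z rule: torus.abs_induct) (simp add: V_field.abs_eq)

lemma snd_H_field: "snd (H_field \<alpha> z) = 0"
  by (induct z rule: torus.abs_induct) (simp add: H_field.abs_eq)

lemma u_field_shear: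
  obtains L :: "real \<times> real \<Rightarrow> real" where "bounded_linear L" "\<And>q. L (u_field \<alpha> t q) = 0"
    "\<And>p q. L p = L q \<Longrightarrow> u_field \<alpha> t (proj p) = u_field \<alpha> t (proj q)"
proof (cases "frac t < 1/2")
  case True
  show ?thesis
    by (rule that[of fst])
       (use True in \<open>auto simp: u_field_def V_field.abs_eq fst_V_field bounded_linear_fst\<close>)
next
  case False
  show ?thesis
    by (rule that[of snd])
       (use False in \<open>auto simp: u_field_def H_field.abs_eq snd_H_field bounded_linear_snd\<close>)
qed

lemma u_field_invariant: "u_field \<alpha> t (proj (p + s *\<^sub>R u_field \<alpha> t (proj p))) = u_field \<alpha> t (proj p)"
proof -
  obtain L :: "real \<times> real \<Rightarrow> real" where L: "bounded_linear L" "\<And>q. L (u_field \<alpha> t q) = 0"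
    "\<And>p q. L p = L q \<Longrightarrow> u_field \<alpha> t (proj p) = u_field \<alpha> t (proj q)"
    using u_field_shear by blast
  interpret L: bounded_linear L by fact
  show ?thesis by (rule L(3)) (simp add: L.add L.scaleR L(2))
qed

lemma half_interval:
  fixes t :: real and k :: nat
  assumes "real k / 2 \<le> t" "t < real k / 2 + 1/2"
  shows "u_field \<alpha> t = u_field \<alpha> (real k / 2)"
proof -
  have "frac t < 1/2 \<longleftrightarrow> even k"
  proof (cases "even k")
    case True
    then obtain m where m: "k = 2 * m" by blast
    have "frac t = t - real m"
      using assms m by (intro frac_unique_iff[THEN iffD2]) (auto simp: add_divide_distrib)
    with assms m show ?thesis by auto
  next
    case False
    then obtain m where m: "k = 2 * m + 1" by (elim oddE)
    have "frac t = t - real m"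
      using assms m by (intro frac_unique_iff[THEN iffD2]) (auto simp: add_divide_distrib)
    with assms m show ?thesis by auto
  qed
  moreover have "frac (real k / 2) < 1/2 \<longleftrightarrow> even k"
  proof (cases "even k")
    case True
    then obtain m where m: "k = 2 * m" by blast
    have "frac (real k / 2) = 0"
      using m by (intro frac_unique_iff[THEN iffD2]) auto
    show ?thesis unfolding \<open>frac (real k / 2) = 0\<close> using True by simp
  next
    case False
    then obtain m where m: "k = 2 * m + 1" by (elim oddE)
    have "frac (real k / 2) = 1/2"
      using m by (intro frac_unique_iff[THEN iffD2]) (auto simp: field_simps)
    with False show ?thesis by auto
  qed
  ultimately show ?thesis by (simp add: u_field_def)
qed

lemma half_interval_not_Ints:
  fixes t :: real and k :: nat
  assumes "real k / 2 < t" "t < real k / 2 + 1/2"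
  shows "2 * t \<notin> \<int>"
proof
  assume "2 * t \<in> \<int>"
  then obtain m :: int where "2 * t = of_int m" by (elim Ints_cases)
  with assms have "real_of_int (int k) < of_int m" "of_int m < real_of_int (int k + 1)" by auto
  then have "int k < m" "m < int k + 1" by (simp_all only: of_int_less_iff)
  then show False by simp
qed

lemma flow_step:
  assumes cont: "continuous_on {0..} \<gamma>"
    and der: "\<And>t. t > 0 \<Longrightarrow> 2 * t \<notin> \<int> \<Longrightarrow>
               (\<gamma> has_vector_derivative u_field \<alpha> t (proj (\<gamma> t))) (at t)"
    and t: "real k / 2 \<le> t" "t \<le> real k / 2 + 1/2"
  shows "\<gamma> t = \<gamma> (real k / 2) + (t - real k / 2) *\<^sub>R u_field \<alpha> (real k / 2) (proj (\<gamma> (real k / 2)))"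
proof -
  define T where "T = real k / 2"
  define W where "W = u_field \<alpha> T"
  have T0: "T \<ge> 0" by (simp add: T_def)
  obtain L :: "real \<times> real \<Rightarrow> real" where L: "bounded_linear L" "\<And>q. L (W q) = 0"
    "\<And>p q. L p = L q \<Longrightarrow> W (proj p) = W (proj q)"
    using u_field_shear W_def by metis
  have cont': "continuous_on {T..T+1/2} \<gamma>"
    by (rule continuous_on_subset[OF cont]) (use T0 in auto)
  have der': "(\<gamma> has_vector_derivative W (proj (\<gamma> s))) (at s within {T..T+1/2})"
    if "s \<in> {T..T+1/2} - {T, T+1/2}" for s
  proof -
    have "T < s" "s < T + 1/2" using that by auto
    then have "(\<gamma> has_vector_derivative u_field \<alpha> s (proj (\<gamma> s))) (at s)"
      using half_interval_not_Ints T0 by (intro der) (auto simp: T_def)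
    moreover have "u_field \<alpha> s = W"
      using \<open>T < s\<close> \<open>s < T + 1/2\<close> by (auto simp: W_def T_def intro!: half_interval)
    ultimately show ?thesis by (simp add: has_vector_derivative_at_within)
  qed
  have Lc: "L (\<gamma> s) = L (\<gamma> T)" if "s \<in> {T..T+1/2}" for s
  proof (rule has_derivative_zero_unique_strong_interval
      [of "{T, T+1/2}" T "T+1/2" "\<lambda>s. L (\<gamma> s)"])
    show "continuous_on {T..T+1/2} (\<lambda>s. L (\<gamma> s))"
      by (intro bounded_linear.continuous_on[OF L(1)] cont')
    show "((\<lambda>s. L (\<gamma> s)) has_derivative (\<lambda>h. 0)) (at x within {T..T+1/2})"
      if "x \<in> {T..T+1/2} - {T, T+1/2}" for x
      using bounded_linear.has_vector_derivative[OF L(1) der'[OF that]] L(2)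
      by (simp add: has_vector_derivative_def)
  qed (use that in auto)
  have "\<gamma> s - (s - T) *\<^sub>R W (proj (\<gamma> T)) = \<gamma> T" if "s \<in> {T..T+1/2}" for s
  proof (rule has_derivative_zero_unique_strong_interval
      [of "{T, T+1/2}" T "T+1/2" "\<lambda>s. \<gamma> s - (s - T) *\<^sub>R W (proj (\<gamma> T))"])
    show "continuous_on {T..T+1/2} (\<lambda>s. \<gamma> s - (s - T) *\<^sub>R W (proj (\<gamma> T)))"
      by (intro continuous_intros cont')
    show "((\<lambda>s. \<gamma> s - (s - T) *\<^sub>R W (proj (\<gamma> T))) has_derivative (\<lambda>h. 0)) (at x within {T..T+1/2})"
      if x: "x \<in> {T..T+1/2} - {T, T+1/2}" for x
    proof -
      have "W (proj (\<gamma> x)) = W (proj (\<gamma> T))" using x by (intro L(3) Lc) auto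
      with der'[OF x]
      have "((\<lambda>s. \<gamma> s - (s - T) *\<^sub>R W (proj (\<gamma> T))) has_vector_derivative 0) (at x within {T..T+1/2})"
        by (auto intro!: derivative_eq_intros)
      then show ?thesis by (simp add: has_vector_derivative_def)
    qed
  qed (use that in auto)
  from this[of t] t show ?thesis by (auto simp: T_def W_def algebra_simps)
qed

lift_definition translate :: "torus \<Rightarrow> real \<times> real \<Rightarrow> torus" is "\<lambda>p v. p + v"
  by (auto simp: algebra_simps)

lemma flow_map_step:
  assumes "is_flow_map (u_field \<alpha>) \<phi>" "real k / 2 \<le> t" "t \<le> real k / 2 + 1/2"
  shows "\<phi> t z = translate (\<phi> (real k / 2) z)
           ((t - real k / 2) *\<^sub>R u_field \<alpha> (real k / 2) (\<phi> (real k / 2) z))"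
proof -
  from assms(1) obtain \<gamma> where \<gamma>: "continuous_on {0..} \<gamma>" "\<And>t. t \<ge> 0 \<Longrightarrow> \<phi> t z = proj (\<gamma> t)"
    "\<And>t. t > 0 \<Longrightarrow> 2 * t \<notin> \<int> \<Longrightarrow> (\<gamma> has_vector_derivative u_field \<alpha> t (\<phi> t z)) (at t)"
    unfolding is_flow_map_def by blast
  have "0 \<le> real k / 2" by simp
  then have "0 \<le> t" using assms(2) by linarith
  have "\<gamma> t = \<gamma> (real k / 2) + (t - real k / 2) *\<^sub>R u_field \<alpha> (real k / 2) (proj (\<gamma> (real k / 2)))"
    using \<gamma> assms by (intro flow_step) auto
  then show ?thesis
    using \<gamma>(2)[of t] \<gamma>(2)[of "real k / 2"] \<open>0 \<le> t\<close> by (simp add: translate.abs_eq)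
qed

lemma half_interval_cover:
  fixes t :: real
  assumes "t \<ge> 0"
  obtains k :: nat where "real k / 2 \<le> t" "t < real k / 2 + 1/2"
proof (rule that[of "nat \<lfloor>2 * t\<rfloor>"])
  show "real (nat \<lfloor>2 * t\<rfloor>) / 2 \<le> t" "t < real (nat \<lfloor>2 * t\<rfloor>) / 2 + 1/2"
    using assms by (simp_all, linarith+)
qed

lemma flow_map_unique:
  assumes "is_flow_map (u_field \<alpha>) \<phi>" "is_flow_map (u_field \<alpha>) \<psi>" "t \<ge> 0"
  shows "\<phi> t = \<psi> t"
proof -
  have *: "\<phi> (real k / 2) z = \<psi> (real k / 2) z" for k z
  proof (induction k)
    case 0
    then show ?case using assms by (simp add: is_flow_map_def)
  next
    case (Suc k)
    have "real k / 2 \<le> real (Suc k) / 2" "real (Suc k) / 2 \<le> real k / 2 + 1/2"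
      by (simp_all add: field_simps)
    from flow_map_step[OF assms(1) this, of z] flow_map_step[OF assms(2) this, of z] show ?case
      unfolding Suc.IH by simp
  qed
  obtain k where k: "real k / 2 \<le> t" "t < real k / 2 + 1/2"
    using half_interval_cover[OF assms(3)] .
  then have "t \<le> real k / 2 + 1/2" by simp
  from flow_map_step[OF assms(1) k(1) this] flow_map_step[OF assms(2) k(1) this] show ?thesis
    unfolding * by (intro ext) simp
qed

lemma flow_map_bij:
  assumes "is_flow_map (u_field \<alpha>) \<phi>" "t \<ge> 0"
  shows "bij (\<phi> t)"
proof -
  define S where "S r s z = translate z (s *\<^sub>R u_field \<alpha> r z)" for r s z
  have S: "S r (-s) (S r s z) = z" for r s z
    by (induct z rule: torus.abs_induct)
       (simp add: S_def translate.abs_eq u_field_invariant)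
  have bijS: "bij (S r s)" for r s
    by (rule o_bij[of "S r (-s)"]) (use S[of r s] S[of r "-s"] in auto)
  have step: "\<phi> t = S (real k / 2) (t - real k / 2) \<circ> \<phi> (real k / 2)"
    if "real k / 2 \<le> t" "t \<le> real k / 2 + 1/2" for k t
    by (rule ext) (simp only: flow_map_step[OF assms(1) that] S_def o_apply)
  have *: "bij (\<phi> (real k / 2))" for k
  proof (induction k)
    case 0
    have "\<phi> 0 = id" using assms by (auto simp: is_flow_map_def)
    then show ?case by (simp add: bij_id[unfolded id_def] id_def)
  next
    case (Suc k)
    have "real k / 2 \<le> real (Suc k) / 2" "real (Suc k) / 2 \<le> real k / 2 + 1/2"
      by (simp_all add: field_simps)
    from step[OF this] show ?case using bij_comp[OF Suc.IH bijS] by metis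
  qed
  obtain k where "real k / 2 \<le> t" "t < real k / 2 + 1/2"
    using half_interval_cover[OF assms(2)] .
  then have "\<phi> t = S (real k / 2) (t - real k / 2) \<circ> \<phi> (real k / 2)"
    by (intro step) auto
  then show ?thesis using bij_comp[OF * bijS] by metis
qed

lemma flow_map_exists: "\<exists>\<phi>. is_flow_map (u_field \<alpha>) \<phi>"
proof -
  define v where "v k p = u_field \<alpha> (real k / 2) (proj p)" for k p
  define w where "w p = rec_nat p (\<lambda>k q. q + (1/2) *\<^sub>R v k q)" for p
  have w0: "w p 0 = p" and wS: "w p (Suc k) = w p k + (1/2) *\<^sub>R v k (w p k)" for p k
    by (simp_all add: w_def)
  define \<gamma> where "\<gamma> p t = (let k = nat \<lfloor>2 * t\<rfloor> in w p k + (t - real k / 2) *\<^sub>R v k (w p k))" for p t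
  have \<gamma>1: "\<gamma> p t = w p k + (t - real k / 2) *\<^sub>R v k (w p k)"
    if "real k / 2 \<le> t" "t < real k / 2 + 1/2" for p k t
  proof -
    have "\<lfloor>2 * t\<rfloor> = int k" using that by (intro floor_unique) auto
    then show ?thesis by (simp add: \<gamma>_def)
  qed
  have \<gamma>2: "\<gamma> p t = w p k + (t - real k / 2) *\<^sub>R v k (w p k)"
    if "t \<in> {real k / 2..real k / 2 + 1/2}" for p k t
  proof (cases "t = real k / 2 + 1/2")
    case True
    then have "\<gamma> p t = w p (Suc k)" by (subst \<gamma>1[of "Suc k"]) (auto simp: field_simps)
    with True show ?thesis by (simp add: wS)
  qed (use that \<gamma>1 in auto)
  have cont_N: "continuous_on {0..real N / 2} (\<gamma> p)" for N p
  proof (induction N)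
    case 0
    then show ?case by simp
  next
    case (Suc N)
    have "continuous_on {real N / 2..real N / 2 + 1/2} (\<gamma> p)"
    proof (rule continuous_on_eq)
      show "continuous_on {real N / 2..real N / 2 + 1/2}
          (\<lambda>t. w p N + (t - real N / 2) *\<^sub>R v N (w p N))"
        by (intro continuous_intros)
    qed (simp add: \<gamma>2)
    with Suc have "continuous_on ({0..real N / 2} \<union> {real N / 2..real N / 2 + 1/2}) (\<gamma> p)"
      by (intro continuous_on_closed_Un) auto
    moreover have "{0..real N / 2} \<union> {real N / 2..real N / 2 + 1/2} = {0..real (Suc N) / 2}"
      by (auto simp: field_simps)
    ultimately show ?case by simp
  qed
  have cont: "continuous_on {0..} (\<gamma> p)" for p
    unfolding continuous_on_eq_continuous_within
  proof
    fix t :: real assume t: "t \<in> {0..}"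
    obtain N :: nat where N: "2 * t < real N" using reals_Archimedean2 by blast
    have "continuous (at t within {0..real N / 2}) (\<gamma> p)"
      using cont_N[of N p] N t by (auto simp: continuous_on_eq_continuous_within)
    moreover have "at t within {0..real N / 2} = at t within {0..}"
      by (rule at_within_nhd[of _ "{..<real N / 2}"]) (use N in auto)
    ultimately show "continuous (at t within {0..}) (\<gamma> p)" by simp
  qed
  have der: "(\<gamma> p has_vector_derivative u_field \<alpha> t (proj (\<gamma> p t))) (at t)"
    if t: "t > 0" "2 * t \<notin> \<int>" for p t
  proof -
    obtain k where k: "real k / 2 \<le> t" "t < real k / 2 + 1/2"
      using half_interval_cover[of t] t by auto
    have "t \<noteq> real k / 2"
    proof
      assume "t = real k / 2"
      then have "2 * t = real k" by simp
      with t(2) show False by simp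
    qed
    with k have k': "real k / 2 < t" by simp
    have "u_field \<alpha> t (proj (\<gamma> p t)) = v k (w p k)"
      unfolding half_interval[OF k] \<gamma>1[OF k] v_def by (rule u_field_invariant)
    moreover have "((\<lambda>t. w p k + (t - real k / 2) *\<^sub>R v k (w p k)) has_vector_derivative v k (w p k)) (at t)"
      by (auto intro!: derivative_eq_intros)
    then have "(\<gamma> p has_vector_derivative v k (w p k)) (at t)"
    proof (rule has_vector_derivative_transform_within_open[of _ _ _ "{real k / 2<..<real k / 2 + 1/2}"])
      show "w p k + (s - real k / 2) *\<^sub>R v k (w p k) = \<gamma> p s"
        if "s \<in> {real k / 2<..<real k / 2 + 1/2}" for s
        using that by (intro \<gamma>1[symmetric]) auto
    qed (use k k' in auto)
    ultimately show ?thesis by simp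
  qed
  have "\<gamma> p 0 = p" for p by (subst \<gamma>1[of 0]) (auto simp: w0)
  moreover have "proj (rep_torus z) = z" for z
    by (rule Quotient3_abs_rep[OF Quotient3_torus])
  ultimately have "is_flow_map (u_field \<alpha>) (\<lambda>t z. proj (\<gamma> (rep_torus z) t))"
    unfolding is_flow_map_def using cont der by metis
  then show ?thesis by blast
qed

end

theory Submission
  imports Defs
begin

text \<open>With \<open>p x = - \<alpha> \<bar>x - 1/2\<bar>\<close>, half a period of the flow is, up to swapping the coordinates, the
  Henon-like map \<open>S (x, y) = (y + p x, x)\<close>. For mean-zero \<open>F\<close> consider two seminorms over segments
  \<open>W\<close> of slope at most \<open>1\<close> and width \<open>|W| \<le> 1\<close>: the best \<open>A\<close> in \<open>|\<integral>\<^sub>W F dx| \<le> A |W|\<^sup>1\<^sup>/\<^sup>2\<close> and the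
  best \<open>B\<close> in \<open>|\<integral>\<^sub>W F dx - \<integral>\<^sub>W\<^sub>' F dx| \<le> B \<delta>\<^sup>1\<^sup>/\<^sup>2\<close>, where \<open>W'\<close> is \<open>W\<close> raised by \<open>\<delta>\<close>.
  The map \<open>S\<close> cuts \<open>W\<close> into at most three pieces on which it is affine and stretches them by
  about \<open>\<alpha>\<close>, while it shrinks vertical offsets by the same factor. A segment of width exactly one
  has integral at most \<open>B\<close>, because its vertical translates average to the mean of \<open>F\<close>. Hence
  composition with \<open>S\<close> takes \<open>(A, B)\<close> to \<open>O(B + A \<alpha>\<^sup>-\<^sup>1\<^sup>/\<^sup>2)\<close> and \<open>O(B \<alpha>\<^sup>-\<^sup>1\<^sup>/\<^sup>2 + A \<alpha>\<^sup>-\<^sup>1)\<close>, so for large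
  \<open>\<alpha>\<close> it halves the norm \<open>max A (12 B)\<close>. Integration by parts along horizontal lines turns this
  into decay of correlations.\<close>

section \<open>Periodic functions of one and two variables\<close>

text \<open>For integer \<open>a\<close> this is a translation. In general the window is cut at the
  integer \<open>of_int k + 1\<close>, and the part beyond it moves back by one period.\<close>

lemma integral_period:
  fixes h :: "real \<Rightarrow> real"
  assumes cont: "continuous_on UNIV h" and per: "\<And>x. h (x + 1) = h x"
  shows "integral {a..a+1} h = integral {0..1} h"
proof -
  have int: "h integrable_on {u..v}" for u v
    by (intro integrable_continuous_real continuous_on_subset[OF cont]) auto
  have shift1: "integral {u+1..v+1} h = integral {u..v} h" for u v
    using integral_shift_Icc_real[of u v h 1] per by (simp add: o_def add.commute)
  have shiftn: "integral {real n..real n + 1} h = integral {0..1} h" for n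
    by (induction n) (use shift1[of "real n" "real n + 1" for n] in \<open>simp_all add: add_ac\<close>)
  have shiftn': "integral {- real n..- real n + 1} h = integral {0..1} h" for n
  proof (induction n)
    case (Suc n)
    have "- real (Suc n) + 1 = - real n" by simp
    with shift1[of "- real (Suc n)" "- real n"] Suc show ?case by metis
  qed simp
  have shift: "integral {of_int k..of_int k + 1} h = integral {0..1} h" for k :: int
    using shiftn shiftn' by (cases k rule: int_cases2) auto
  define k where "k = \<lfloor>a\<rfloor>"
  have k: "of_int k \<le> a" "a \<le> of_int k + 1" unfolding k_def by linarith+
  have "integral {a..a+1} h = integral {a..of_int k + 1} h + integral {of_int k + 1..a+1} h"
    using k int by (intro Henstock_Kurzweil_Integration.integral_combine[symmetric]) auto
  also have "integral {of_int k + 1..a+1} h = integral {of_int k..a} h"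
    by (rule shift1)
  also have "integral {a..of_int k + 1} h + integral {of_int k..a} h = integral {of_int k..of_int k + 1} h"
    using k int by (subst add.commute, intro Henstock_Kurzweil_Integration.integral_combine) auto
  finally show ?thesis using shift by simp
qed

text \<open>These are the lifts of continuous functions on the torus. Continuity is included so that
  every section integral exists and iterated integrals may be swapped.\<close>

definition periodic2 :: "(real \<times> real \<Rightarrow> real) \<Rightarrow> bool" where
  "periodic2 F \<longleftrightarrow> continuous_on UNIV F \<and> (\<forall>x y. F (x + 1, y) = F (x, y) \<and> F (x, y + 1) = F (x, y))"

definition mean :: "(real \<times> real \<Rightarrow> real) \<Rightarrow> real" where
  "mean F = integral {0..1} (\<lambda>x. integral {0..1} (\<lambda>y. F (x, y)))"

lemma periodic2_continuous:
  assumes "periodic2 F" "continuous_on A a" "continuous_on A b"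
  shows "continuous_on A (\<lambda>t. F (a t, b t))"
  using assms by (auto simp: periodic2_def intro!: continuous_on_compose2[of UNIV F] continuous_intros)

lemma periodic2_fst: "periodic2 F \<Longrightarrow> F (x + 1, y) = F (x, y)"
  and periodic2_snd: "periodic2 F \<Longrightarrow> F (x, y + 1) = F (x, y)"
  by (auto simp: periodic2_def)

lemma continuous_on_section_integral:
  assumes "continuous_on UNIV (F :: real \<times> real \<Rightarrow> real)"
  shows "continuous_on UNIV (\<lambda>x. integral {a..b} (\<lambda>y. F (x, y)))"
  using integral_continuous_on_param[of UNIV a b "\<lambda>x y. F (x, y)"] continuous_on_subset[OF assms]
  by (simp add: split_beta)

lemma integral_swap_real:
  assumes "continuous_on UNIV (F :: real \<times> real \<Rightarrow> real)"
  shows "integral {a..b} (\<lambda>x. integral {c..d} (\<lambda>y. F (x, y))) =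
         integral {c..d} (\<lambda>y. integral {a..b} (\<lambda>x. F (x, y)))"
  using integral_swap_continuous[of a c b d "\<lambda>x y. F (x, y)"] continuous_on_subset[OF assms]
  by simp

text \<open>The vertical window may start at a height \<open>b x\<close> that depends arbitrarily on
  \<open>x\<close>, since each inner integral is over a full period. This covers shears as well as
  slanted segments.\<close>

lemma mean_periods:
  assumes F: "periodic2 F"
  shows "integral {a..a+1} (\<lambda>x. integral {b x..b x+1} (\<lambda>y. F (x, y))) = mean F"
proof -
  have c: "continuous_on UNIV F" using F by (simp add: periodic2_def)
  have "integral {b x..b x+1} (\<lambda>y. F (x, y)) = integral {0..1} (\<lambda>y. F (x, y))" for x
    by (rule integral_period)
       (auto intro!: periodic2_continuous[OF F] continuous_intros simp: periodic2_snd[OF F])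
  moreover have "integral {a..a+1} (\<lambda>x. integral {0..1} (\<lambda>y. F (x, y))) = mean F"
    unfolding mean_def
    by (rule integral_period) (auto simp: periodic2_fst[OF F] intro: continuous_on_section_integral[OF c])
  ultimately show ?thesis by simp
qed

lemma mean_add_mult:
  assumes F: "periodic2 F" and G: "periodic2 G"
  shows "mean (\<lambda>z. F z + c * G z) = mean F + c * mean G"
proof -
  have cF: "continuous_on UNIV F" and cG: "continuous_on UNIV G"
    using F G by (simp_all add: periodic2_def)
  have "integral {0..1} (\<lambda>y. F (x, y) + c * G (x, y)) =
        integral {0..1} (\<lambda>y. F (x, y)) + c * integral {0..1} (\<lambda>y. G (x, y))" for x
    by (subst Henstock_Kurzweil_Integration.integral_add)
       (auto intro!: integrable_continuous_real periodic2_continuous[OF F] periodic2_continuous[OF G]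
          continuous_intros)
  then show ?thesis
    unfolding mean_def
    by (simp, subst Henstock_Kurzweil_Integration.integral_add)
       (auto intro!: integrable_continuous_real continuous_intros
          continuous_on_subset[OF continuous_on_section_integral[OF cF]]
          continuous_on_subset[OF continuous_on_section_integral[OF cG]])
qed

lemma mean_diff_const:
  assumes F: "periodic2 F"
  shows "mean (\<lambda>z. F z - c) = mean F - c"
  using mean_add_mult[OF F, of "\<lambda>_. 1" "- c"] by (simp add: periodic2_def mean_def)

section \<open>Shears and the coordinate swap\<close>

text \<open>For \<open>q x = 2 * \<tau> * tent \<alpha> x\<close> this lifts the motion along
  \<open>V_field \<alpha>\<close> during a time \<tau>.\<close>

definition shear :: "(real \<Rightarrow> real) \<Rightarrow> real \<times> real \<Rightarrow> real \<times> real" where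
  "shear q z = (fst z, snd z + q (fst z))"

definition periodic1 :: "(real \<Rightarrow> real) \<Rightarrow> bool" where
  "periodic1 q \<longleftrightarrow> continuous_on UNIV q \<and> (\<forall>x. q (x + 1) = q x)"

lemma periodic2_shear:
  assumes "periodic1 q" "periodic2 F"
  shows "periodic2 (F \<circ> shear q)"
proof -
  have q: "continuous_on UNIV (\<lambda>z::real \<times> real. q (fst z))"
    using assms(1) by (auto simp: periodic1_def intro!: continuous_on_compose2[of UNIV q] continuous_intros)
  have "F (x, y + 1 + q x) = F (x, y + q x)" for x y
    using periodic2_snd[OF assms(2), of x "y + q x"] by (simp add: add_ac)
  then show ?thesis
    using assms periodic2_continuous[OF assms(2) continuous_on_fst[OF continuous_on_id]
        continuous_on_add[OF continuous_on_snd[OF continuous_on_id] q]]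
    by (simp add: periodic2_def shear_def o_def periodic1_def)
qed

lemma periodic2_swap: "periodic2 F \<Longrightarrow> periodic2 (F \<circ> prod.swap)"
  using periodic2_continuous[OF _ continuous_on_snd[OF continuous_on_id] continuous_on_fst[OF continuous_on_id]]
  by (simp add: periodic2_def o_def prod.swap_def)

lemma mean_shear:
  assumes q: "periodic1 q" and F: "periodic2 F"
  shows "mean (F \<circ> shear q) = mean F"
proof -
  have "integral {0..1} (\<lambda>y. F (x, y + q x)) = integral {q x..q x + 1} (\<lambda>y. F (x, y))" for x
    using integral_shift_Icc_real[of 0 1 "\<lambda>y. F (x, y)" "q x"] by (simp add: o_def add_ac)
  then show ?thesis
    using mean_periods[OF F, of 0 q] by (simp add: mean_def shear_def)
qed

lemma mean_swap:
  assumes F: "periodic2 F"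
  shows "mean (F \<circ> prod.swap) = mean F"
  using integral_swap_real[of F 0 1 0 1] F by (simp add: mean_def periodic2_def)

text \<open>Conjugation by the swap turns the horizontal shear into the vertical one, so the two
  different half-periods become two applications of this single map.\<close>

definition henon :: "(real \<Rightarrow> real) \<Rightarrow> real \<times> real \<Rightarrow> real \<times> real" where
  "henon q = prod.swap \<circ> shear q"

lemma henon_Pair: "henon q (x, y) = (y + q x, x)"
  by (simp add: henon_def shear_def)

lemma periodic2_henon: "periodic1 q \<Longrightarrow> periodic2 F \<Longrightarrow> periodic2 (F \<circ> henon q)"
  unfolding henon_def o_assoc by (intro periodic2_shear periodic2_swap)

lemma mean_henon: "periodic1 q \<Longrightarrow> periodic2 F \<Longrightarrow> mean (F \<circ> henon q) = mean F"
  unfolding henon_def o_assoc by (simp add: mean_shear mean_swap periodic2_swap)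

section \<open>Integrals along line segments\<close>

text \<open>Here \<open>y\<close> is the intercept at first coordinate 0, not the height at
  \<open>u\<close>, and the integral is with respect to the first coordinate, not arc
  length.\<close>

definition line_int :: "(real \<times> real \<Rightarrow> real) \<Rightarrow> real \<Rightarrow> real \<Rightarrow> real \<Rightarrow> real \<Rightarrow> real" where
  "line_int F u v y m = integral {u..v} (\<lambda>x. F (x, y + m * x))"

lemma line_int_combine:
  assumes "periodic2 F" "u \<le> w" "w \<le> v"
  shows "line_int F u v y m = line_int F u w y m + line_int F w v y m"
proof -
  have "(\<lambda>x. F (x, y + m * x)) integrable_on {u..v}"
    using assms(1) by (intro integrable_continuous_real periodic2_continuous continuous_intros)
  then show ?thesis using assms by (simp add: line_int_def Henstock_Kurzweil_Integration.integral_combine)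
qed

text \<open>The slope condition is stable under the dynamics: the image of a segment under an
  expanding branch has slope \<open>1 / c\<close> with \<open>\<bar>c\<bar> \<ge> 1\<close>.\<close>

definition segment_bounds :: "(real \<times> real \<Rightarrow> real) \<Rightarrow> real \<Rightarrow> real \<Rightarrow> bool" where
  "segment_bounds F A B \<longleftrightarrow>
     (\<forall>u v y m. u \<le> v \<and> v \<le> u + 1 \<and> \<bar>m\<bar> \<le> 1 \<longrightarrow> \<bar>line_int F u v y m\<bar> \<le> A * sqrt (v - u)) \<and>
     (\<forall>u v y y' m. u \<le> v \<and> v \<le> u + 1 \<and> \<bar>m\<bar> \<le> 1 \<and> \<bar>y' - y\<bar> \<le> 1 \<longrightarrow>
        \<bar>line_int F u v y' m - line_int F u v y m\<bar> \<le> B * sqrt \<bar>y' - y\<bar>)"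

lemma segment_boundsD:
  assumes "segment_bounds F A B" "u \<le> v" "v \<le> u + 1" "\<bar>m\<bar> \<le> 1"
  shows "\<bar>line_int F u v y m\<bar> \<le> A * sqrt (v - u)"
    and "\<bar>y' - y\<bar> \<le> 1 \<Longrightarrow> \<bar>line_int F u v y' m - line_int F u v y m\<bar> \<le> B * sqrt \<bar>y' - y\<bar>"
  using assms by (auto simp: segment_bounds_def)

lemma segment_bounds_nonneg:
  assumes "segment_bounds F A B"
  shows "A \<ge> 0" "B \<ge> 0"
proof -
  have "\<bar>line_int F 0 1 0 0\<bar> \<le> A" "\<bar>line_int F 0 1 1 0 - line_int F 0 1 0 0\<bar> \<le> B"
    using segment_boundsD(1)[OF assms, of 0 1 0 0] segment_boundsD(2)[OF assms, of 0 1 0 1 0] by simp_all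
  then show "A \<ge> 0" "B \<ge> 0" by linarith+
qed

text \<open>The average over all vertical translates of a segment of unit width is the mean of \<open>F\<close>, so
  vanishing mean turns the oscillation bound into a bound on the integral itself.\<close>

lemma unit_segment_bound:
  assumes F: "periodic2 F" "mean F = 0" and b: "segment_bounds F A B" and m: "\<bar>m\<bar> \<le> 1"
  shows "\<bar>line_int F c (c + 1) y m\<bar> \<le> B"
proof -
  have cF: "continuous_on UNIV (\<lambda>(t, x). F (x, t + m * x))"
    unfolding split_beta by (intro periodic2_continuous[OF F(1)] continuous_intros)
  have cJ: "continuous_on UNIV (\<lambda>t. line_int F c (c + 1) t m)"
    using continuous_on_section_integral[OF cF] by (simp add: line_int_def)
  have "integral {y..y+1} (\<lambda>t. line_int F c (c+1) t m) =
        integral {c..c+1} (\<lambda>x. integral {y..y+1} (\<lambda>t. F (x, t + m * x)))"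
    using integral_swap_real[OF cF] by (simp add: line_int_def)
  also have "\<dots> = integral {c..c+1} (\<lambda>x. integral {y + m * x..y + m * x + 1} (\<lambda>t. F (x, t)))"
    using integral_shift_Icc_real[of y "y + 1" "\<lambda>t. F (x, t)" "m * x" for x] by (simp add: o_def add_ac)
  also have "\<dots> = 0" using mean_periods[OF F(1), of c "\<lambda>x. y + m * x"] F(2) by simp
  finally have "line_int F c (c + 1) y m =
      integral {y..y+1} (\<lambda>t. line_int F c (c + 1) y m - line_int F c (c + 1) t m)"
    using continuous_on_subset[OF cJ]
    by (subst Henstock_Kurzweil_Integration.integral_diff) (auto intro!: integrable_continuous_real)
  also have "norm \<dots> \<le> B * (y + 1 - y)"
  proof (rule integral_bound)
    fix t assume t: "t \<in> {y..y+1}"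
    have "\<bar>line_int F c (c + 1) y m - line_int F c (c + 1) t m\<bar> \<le> B * sqrt \<bar>y - t\<bar>"
      using t m by (intro segment_boundsD[OF b]) auto
    also have "\<dots> \<le> B * 1" using t segment_bounds_nonneg[OF b] by (intro mult_left_mono) auto
    finally show "norm (line_int F c (c + 1) y m - line_int F c (c + 1) t m) \<le> B" by simp
  qed (auto intro!: continuous_intros continuous_on_subset[OF cJ])
  finally show ?thesis by simp
qed

lemma real_nonneg_cases_nat:
  assumes "(L::real) \<ge> 0"
  obtains n :: nat and l where "L = real n + l" "0 \<le> l" "l \<le> 1"
  using assms that[of "nat \<lfloor>L\<rfloor>" "frac L"] by (auto simp: frac_def less_imp_le[OF frac_lt_1[unfolded frac_def]])

text \<open>Unit pieces are split off one at a time and cost \<open>B\<close> each by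
  \<open>unit_segment_bound\<close>; only the last piece, of width at most 1, is charged to
  \<open>A\<close>.\<close>

lemma long_segment_bound:
  assumes F: "periodic2 F" "mean F = 0" and b: "segment_bounds F A B" and m: "\<bar>m\<bar> \<le> 1" and L: "L \<ge> 0"
  shows "\<bar>line_int F a (a + L) y m\<bar> \<le> B * L + A * sqrt L"
proof -
  obtain n :: nat and l where l: "L = real n + l" "0 \<le> l" "l \<le> 1"
    using real_nonneg_cases_nat[OF L] .
  have "\<bar>line_int F a (a + (real n + l)) y m\<bar> \<le> B * real n + A * sqrt l"
  proof (induction n arbitrary: a)
    case 0
    then show ?case using segment_boundsD(1)[OF b, of a "a + l"] l m by simp
  next
    case (Suc n)
    have "line_int F a (a + (real (Suc n) + l)) y m =
        line_int F a (a + 1) y m + line_int F (a + 1) ((a + 1) + (real n + l)) y m"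
      using line_int_combine[OF F(1), of a "a + 1" "(a + 1) + (real n + l)"] l by (simp add: add_ac)
    with Suc[of "a + 1"] unit_segment_bound[OF F b m, of a y] show ?case
      by (auto simp: algebra_simps)
  qed
  also have "\<dots> \<le> B * L + A * sqrt L"
    using l segment_bounds_nonneg[OF b] by (intro add_mono mult_left_mono) auto
  finally show ?thesis using l by simp
qed

text \<open>The segment splits into \<open>n\<close> unit pieces and a remainder, at most
  \<open>L + 1\<close> pieces in the count used here, and each obeys the oscillation bound
  separately.\<close>

lemma long_segment_oscillation:
  assumes F: "periodic2 F" and b: "segment_bounds F A B" and m: "\<bar>m\<bar> \<le> 1" and L: "L \<ge> 0"
    and y: "\<bar>y' - y\<bar> \<le> 1"
  shows "\<bar>line_int F a (a + L) y' m - line_int F a (a + L) y m\<bar> \<le> (L + 1) * (B * sqrt \<bar>y' - y\<bar>)"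
proof -
  obtain n :: nat and l where l: "L = real n + l" "0 \<le> l" "l \<le> 1"
    using real_nonneg_cases_nat[OF L] .
  define D where "D = B * sqrt \<bar>y' - y\<bar>"
  have D: "D \<ge> 0" using segment_bounds_nonneg[OF b] by (simp add: D_def)
  have step: "\<bar>line_int F a v y' m - line_int F a v y m\<bar> \<le> D" if "a \<le> v" "v \<le> a + 1" for a v
    unfolding D_def using that m y by (intro segment_boundsD[OF b]) auto
  have "\<bar>line_int F a (a + (real n + l)) y' m - line_int F a (a + (real n + l)) y m\<bar> \<le> (real n + 1) * D"
  proof (induction n arbitrary: a)
    case 0
    then show ?case using step[of a "a + l"] l by simp
  next
    case (Suc n)
    have "line_int F a (a + (real (Suc n) + l)) z m =
        line_int F a (a + 1) z m + line_int F (a + 1) ((a + 1) + (real n + l)) z m" for z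
      using line_int_combine[OF F(1), of a "a + 1" "(a + 1) + (real n + l)"] l by (simp add: add_ac)
    with Suc[of "a + 1"] step[of a "a + 1"] show ?case
      by (simp add: algebra_simps)
  qed
  also have "\<dots> \<le> (L + 1) * D" using l D by (intro mult_right_mono) auto
  finally show ?thesis using l by (simp add: D_def)
qed

text \<open>Substituting \<open>X = c * x + e\<close> rewrites the curve as a graph over its own
  first coordinate. The width grows by \<open>\<bar>c\<bar>\<close>, which the Jacobian
  \<open>1 / \<bar>c\<bar>\<close> offsets; \<open>min\<close> picks the left endpoint when
  \<open>c < 0\<close> reverses orientation.\<close>

lemma line_int_affine:
  assumes F: "periodic2 F" and c: "c \<noteq> 0" and uv: "u \<le> v"
  shows "integral {u..v} (\<lambda>x. F (c * x + e, x)) =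
    (1 / \<bar>c\<bar>) * line_int F (min (c * u) (c * v) + e) (min (c * u) (c * v) + e + \<bar>c\<bar> * (v - u)) (- e / c) (1 / c)"
proof -
  define f where "f X = F (X, - e / c + 1 / c * X)" for X
  have cf: "continuous_on A f" for A
    unfolding f_def by (intro periodic2_continuous[OF F] continuous_intros)
  \<comment> \<open>The substitution rule expresses the oriented integral as a difference. According
    to the sign of \<open>c\<close>, one of the two intervals is empty or a point and contributes
    nothing.\<close>
  have "((\<lambda>x. c *\<^sub>R f (c * x + e)) has_integral
      (integral {c * u+e..c * v+e} f - integral {c * v+e..c * u+e} f)) {u..v}"
  proof (rule has_integral_substitution_general[of "{}" u v _ "min (c * u) (c * v) + e" "max (c * u) (c * v) + e"])
    show "(\<lambda>x. c * x + e) ` {u..v} \<subseteq> {min (c * u) (c * v) + e..max (c * u) (c * v) + e}"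
    proof clarsimp
      fix x assume x: "u \<le> x" "x \<le> v"
      show "min (c * u) (c * v) \<le> c * x \<and> c * x \<le> max (c * u) (c * v)"
        using x c by (cases "c > 0") (auto simp: min_def max_def mult_le_cancel_left)
    qed
  qed (use uv cf in \<open>auto intro!: continuous_intros derivative_eq_intros\<close>)
  moreover have "f (c * x + e) = F (c * x + e, x)" for x
    using c by (simp add: f_def field_simps)
  ultimately have *: "c * integral {u..v} (\<lambda>x. F (c * x + e, x)) =
      integral {c * u+e..c * v+e} f - integral {c * v+e..c * u+e} f"
    by (metis (no_types, lifting) integral_cmul integral_unique real_scaleR_def ext)
  have J: "line_int F l r (- e / c) (1 / c) = integral {l..r} f" for l r
    by (simp add: line_int_def f_def[abs_def])
  show ?thesis
  proof (cases "c > 0")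
    case True
    then have l: "min (c * u) (c * v) + e = c * u + e" "c * u + e + \<bar>c\<bar> * (v - u) = c * v + e"
      using uv by (auto simp: min_def algebra_simps)
    have "integral {c * v + e..c * u + e} f = 0"
      using True uv by (cases "u = v") auto
    with * True show ?thesis unfolding J l by (simp add: field_simps)
  next
    case False
    then have l: "min (c * u) (c * v) + e = c * v + e" "c * v + e + \<bar>c\<bar> * (v - u) = c * u + e"
      using uv by (auto simp: min_def algebra_simps mult_le_cancel_left)
    have "integral {c * u + e..c * v + e} f = 0"
      using False c uv by (cases "u = v") auto
    with * False c show ?thesis unfolding J l by (simp add: field_simps)
  qed
qed

text \<open>For \<open>d \<ge> 0\<close>, splitting the integral over \<open>{a..a + d + L}\<close>
  in two ways shows that the windows differ by two end pieces of width \<open>d\<close>, each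
  bounded through \<open>A\<close>. This remains valid when the windows are disjoint.\<close>

lemma line_int_slide:
  assumes F: "periodic2 F" and b: "segment_bounds F A B" and m: "\<bar>m\<bar> \<le> 1" and L: "L \<ge> 0"
    and d: "\<bar>d\<bar> \<le> 1"
  shows "\<bar>line_int F (a + d) (a + d + L) y m - line_int F a (a + L) y m\<bar> \<le> 2 * A * sqrt \<bar>d\<bar>"
proof -
  have *: "\<bar>line_int F (a + d) (a + d + L) y m - line_int F a (a + L) y m\<bar> \<le> 2 * A * sqrt d"
    if d: "0 \<le> d" "d \<le> 1" for a d
  proof -
    have "line_int F a (a + d) y m + line_int F (a + d) (a + d + L) y m =
          line_int F a (a + L) y m + line_int F (a + L) (a + d + L) y m"
      using line_int_combine[OF F, of a "a + d" "a + d + L"]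
        line_int_combine[OF F, of a "a + L" "a + d + L"] d L by simp
    moreover have "\<bar>line_int F a (a + d) y m\<bar> \<le> A * sqrt d"
      using segment_boundsD(1)[OF b, of a "a + d"] d m by simp
    moreover have "\<bar>line_int F (a + L) (a + d + L) y m\<bar> \<le> A * sqrt d"
      using segment_boundsD(1)[OF b, of "a + L" "a + d + L"] d m by simp
    ultimately show ?thesis by linarith
  qed
  show ?thesis
  proof (cases "d \<ge> 0")
    case True
    then show ?thesis using *[of d a] d by simp
  next
    case False
    then show ?thesis using *[of "- d" "a + d"] d by (simp add: abs_minus_commute)
  qed
qed

section \<open>Contraction under the tent map\<close>

text \<open>The displacement over half a period: the velocity profile in \<open>V_field\<close>
  times the duration 1/2.\<close>

definition tent :: "real \<Rightarrow> real \<Rightarrow> real" where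
  "tent \<alpha> x = - \<alpha> * \<bar>frac x - 1/2\<bar>"

text \<open>The tent has its kinks exactly at the half-integers when \<alpha> is nonzero, so these
  are intervals on which it is affine.\<close>

definition in_branch :: "real \<Rightarrow> real \<Rightarrow> bool" where
  "in_branch u v \<longleftrightarrow> (\<exists>k::int. of_int k / 2 \<le> u \<and> v \<le> (of_int k + 1) / 2)"

lemma tent_eqs:
  assumes "of_int j \<le> x" "x \<le> of_int j + 1"
  shows "tent \<alpha> x = - \<alpha> * \<bar>x - of_int j - 1/2\<bar>"
proof (cases "x = of_int j + 1")
  case True
  then show ?thesis by (simp add: tent_def)
next
  case False
  with assms have "frac x = x - of_int j" by (intro frac_unique_iff[THEN iffD2]) auto
  then show ?thesis by (simp add: tent_def)
qed

lemma tent_in_branch: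
  assumes "in_branch u v"
  obtains s e where "\<bar>s\<bar> = 1" "\<And>x. x \<in> {u..v} \<Longrightarrow> tent \<alpha> x = s * \<alpha> * x + e"
proof -
  obtain k :: int where k: "of_int k / 2 \<le> u" "v \<le> (of_int k + 1) / 2"
    using assms by (auto simp: in_branch_def)
  define j where "j = k div 2"
  show ?thesis
  proof (cases "even k")
    case True
    then have kj: "real_of_int k = 2 * of_int j" by (auto simp: j_def)
    show ?thesis
    proof (rule that[of 1 "- \<alpha> * (of_int j + 1/2)"])
      show "tent \<alpha> x = 1 * \<alpha> * x + - \<alpha> * (of_int j + 1/2)" if "x \<in> {u..v}" for x
        using that k kj by (subst tent_eqs[of j]) (auto simp: algebra_simps)
    qed simp
  next
    case False
    then have "k = 2 * j + 1" by (simp add: j_def)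
    then have kj: "real_of_int k = 2 * of_int j + 1" by simp
    show ?thesis
    proof (rule that[of "- 1" "\<alpha> * (of_int j + 1/2)"])
      show "tent \<alpha> x = - 1 * \<alpha> * x + \<alpha> * (of_int j + 1/2)" if "x \<in> {u..v}" for x
        using that k kj by (subst tent_eqs[of j]) (auto simp: algebra_simps)
    qed simp
  qed
qed

text \<open>The formula of \<open>tent_eqs\<close> holds up to both ends of a closed unit interval,
  so adjacent intervals glue continuously across the integers where \<open>frac\<close> jumps. The
  factor \<open>c\<close> allows for partial time steps.\<close>

lemma periodic1_tent: "periodic1 (\<lambda>x. c * tent \<alpha> x)"
proof -
  have "continuous_on UNIV (tent \<alpha>)"
    unfolding continuous_on_eq_continuous_at[OF open_UNIV]
  proof
    fix x :: real
    have "continuous_on {of_int j..of_int j + 1} (tent \<alpha>)" for j :: int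
      by (rule continuous_on_eq[of _ "\<lambda>x. - \<alpha> * \<bar>x - of_int j - 1/2\<bar>"])
         (auto intro!: continuous_intros simp: tent_eqs)
    from this[of "\<lceil>x\<rceil> - 1"] this[of "\<lceil>x\<rceil>"]
    have "continuous_on ({of_int \<lceil>x\<rceil> - 1..of_int \<lceil>x\<rceil>} \<union> {of_int \<lceil>x\<rceil>..of_int \<lceil>x\<rceil> + 1}) (tent \<alpha>)"
      by (intro continuous_on_closed_Un) auto
    then have "continuous_on {of_int \<lceil>x\<rceil> - 1<..<of_int \<lceil>x\<rceil> + 1} (tent \<alpha>)"
      by (rule continuous_on_subset) auto
    moreover have "x \<in> {of_int \<lceil>x\<rceil> - 1<..<of_int \<lceil>x\<rceil> + 1}" by (simp, linarith)
    ultimately show "isCont (tent \<alpha>) x"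
      by (simp add: continuous_on_eq_continuous_at)
  qed
  moreover have "tent \<alpha> (x + 1) = tent \<alpha> x" for x
    using frac_cong[of "x + 1" x] by (simp add: tent_def)
  ultimately show ?thesis by (auto simp: periodic1_def intro!: continuous_intros)
qed

text \<open>On a branch, the segment of slope \<open>m\<close> is mapped to the curve
  \<open>(c * x + y + e, x)\<close> with \<open>c = m + s * \<alpha>\<close>, a line of slope
  \<open>1 / c\<close>. Its integral is therefore \<open>1 / \<bar>c\<bar>\<close> times one over a
  segment stretched by \<open>\<bar>c\<bar> \<ge> l\<close>. Raising the original by
  \<open>d\<close> displaces the image horizontally by \<open>d\<close>: its window slides by
  \<open>d\<close> and its intercept changes by only \<open>- d / c\<close>.\<close>

lemma branch_bounds:
  assumes F: "periodic2 F" "mean F = 0" and b: "segment_bounds F A B"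
    and l: "1 \<le> l" "l \<le> \<alpha> - 1" and m: "\<bar>m\<bar> \<le> 1"
    and uv: "u \<le> v" "v \<le> u + 1" "in_branch u v"
  shows "\<bar>line_int (F \<circ> henon (tent \<alpha>)) u v y m\<bar> \<le> (B + A / sqrt l) * sqrt (v - u)" (is ?bound)
    and "\<bar>y' - y\<bar> \<le> 1 \<Longrightarrow>
      \<bar>line_int (F \<circ> henon (tent \<alpha>)) u v y' m - line_int (F \<circ> henon (tent \<alpha>)) u v y m\<bar>
        \<le> (2 * B / sqrt l + 2 * A / l) * sqrt \<bar>y' - y\<bar>" (is "_ \<Longrightarrow> ?osc")
proof -
  obtain s e where s: "\<bar>s\<bar> = 1" and tent: "\<And>x. x \<in> {u..v} \<Longrightarrow> tent \<alpha> x = s * \<alpha> * x + e"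
    using tent_in_branch[OF uv(3)] by metis
  define c where "c = m + s * \<alpha>"
  have "\<bar>s * \<alpha>\<bar> = \<alpha>" using s l by (simp add: abs_mult)
  then have c: "l \<le> \<bar>c\<bar>" using l m by (simp add: c_def)
  then have c0: "c \<noteq> 0" "\<bar>c\<bar> \<ge> 1" "\<bar>c\<bar> > 0" using l by auto
  then have c1: "\<bar>1 / c\<bar> \<le> 1" by (simp add: field_simps)
  have AB: "A \<ge> 0" "B \<ge> 0" using segment_bounds_nonneg[OF b] .
  define w where "w = v - u"
  have w: "0 \<le> w" "w \<le> 1" using uv by (auto simp: w_def)
  define L where "L = \<bar>c\<bar> * w"
  have L: "L \<ge> 0" using w by (simp add: L_def)
  define a where "a y = min (c * u) (c * v) + (y + e)" for y
  have J: "line_int (F \<circ> henon (tent \<alpha>)) u v y m =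
      1 / \<bar>c\<bar> * line_int F (a y) (a y + L) (- (y + e) / c) (1 / c)" for y
  proof -
    have "line_int (F \<circ> henon (tent \<alpha>)) u v y m = integral {u..v} (\<lambda>x. F (c * x + (y + e), x))"
      unfolding line_int_def
      by (intro integral_cong) (simp add: henon_Pair tent c_def algebra_simps)
    then show ?thesis
      using line_int_affine[OF F(1) c0(1) uv(1), of "y + e"] by (simp add: a_def L_def w_def)
  qed
  have sq: "1 / sqrt \<bar>c\<bar> \<le> 1 / sqrt l" "1 / \<bar>c\<bar> \<le> 1 / l"
    using c l by (auto intro!: divide_left_mono mult_pos_pos)
  show ?bound
  proof -
    have "\<bar>line_int (F \<circ> henon (tent \<alpha>)) u v y m\<bar> \<le> 1 / \<bar>c\<bar> * (B * L + A * sqrt L)"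
      unfolding J abs_mult using long_segment_bound[OF F b c1 L]
      by (simp add: mult_left_mono divide_right_mono)
    also have "\<dots> = B * w + A * (1 / sqrt \<bar>c\<bar>) * sqrt w"
      using c0 by (simp add: L_def real_sqrt_mult field_simps flip: power2_eq_square)
    \<comment> \<open>The term \<open>B * w\<close> does not shrink with \<open>l\<close>; as
      \<open>w \<le> 1\<close> it still fits the square-root form of the bound.\<close>
    also have "\<dots> \<le> B * sqrt w + A * (1 / sqrt l) * sqrt w"
    proof -
      have "w \<le> sqrt w" using w by (intro real_le_rsqrt) (simp add: power2_eq_square mult_left_le)
      then show ?thesis using AB sq w by (intro add_mono mult_left_mono mult_right_mono) auto
    qed
    finally show ?thesis by (simp add: w_def algebra_simps)
  qed
  show ?osc if y: "\<bar>y' - y\<bar> \<le> 1"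
  proof -
    define d where "d = y' - y"
    let ?J = "\<lambda>a y. line_int F a (a + L) (- (y + e) / c) (1 / c)"
    have ay: "a y' = a y + d" by (simp add: a_def d_def)
    have "- (y' + e) / c - - (y + e) / c = - d / c" using c0 by (simp add: d_def field_simps)
    then have yd: "\<bar>- (y' + e) / c - - (y + e) / c\<bar> = \<bar>d\<bar> / \<bar>c\<bar>" by simp
    have "\<bar>d\<bar> / \<bar>c\<bar> \<le> 1" using y c0 by (simp add: d_def field_simps)
    \<comment> \<open>The displacement is taken in two stages: first the intercept changes over a
      fixed window, then the window slides along a fixed line.\<close>
    then have "\<bar>?J (a y') y' - ?J (a y') y\<bar> \<le> (L + 1) * (B * sqrt (\<bar>d\<bar> / \<bar>c\<bar>))"
      using long_segment_oscillation[OF F(1) b c1 L, of "- (y' + e) / c" "- (y + e) / c" "a y'"]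
      unfolding yd by simp
    moreover have "\<bar>?J (a y') y - ?J (a y) y\<bar> \<le> 2 * A * sqrt \<bar>d\<bar>"
      unfolding ay using line_int_slide[OF F(1) b c1 L] y by (simp add: d_def)
    ultimately have "\<bar>?J (a y') y' - ?J (a y) y\<bar> \<le> (L + 1) * (B * sqrt (\<bar>d\<bar> / \<bar>c\<bar>)) + 2 * A * sqrt \<bar>d\<bar>"
      by linarith
    then have "\<bar>line_int (F \<circ> henon (tent \<alpha>)) u v y' m - line_int (F \<circ> henon (tent \<alpha>)) u v y m\<bar>
        \<le> 1 / \<bar>c\<bar> * ((L + 1) * (B * sqrt (\<bar>d\<bar> / \<bar>c\<bar>)) + 2 * A * sqrt \<bar>d\<bar>)"
      unfolding J right_diff_distrib[symmetric] abs_mult using c0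
      by (simp add: mult_left_mono divide_right_mono)
    also have "\<dots> = (w + 1 / \<bar>c\<bar>) * (B * (1 / sqrt \<bar>c\<bar>) * sqrt \<bar>d\<bar>) + 2 * A * (1 / \<bar>c\<bar>) * sqrt \<bar>d\<bar>"
      using c0 by (simp add: L_def real_sqrt_divide field_simps)
    also have "\<dots> \<le> 2 * (B * (1 / sqrt l) * sqrt \<bar>d\<bar>) + 2 * A * (1 / l) * sqrt \<bar>d\<bar>"
      using AB sq w c1 l by (intro add_mono mult_mono) auto
    finally show ?thesis by (simp add: d_def algebra_simps)
  qed
qed

text \<open>With \<open>k = \<lfloor>2 * u\<rfloor>\<close> the only possible cuts are
  \<open>(k + 1) / 2\<close> and \<open>(k + 2) / 2\<close>, because
  \<open>v \<le> u + 1 < (k + 3) / 2\<close>. Truncating both at \<open>v\<close> may leave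
  degenerate pieces, but always gives exactly three.\<close>

lemma three_branches:
  assumes "u \<le> v" "v \<le> u + 1"
  obtains w1 w2 where "u \<le> w1" "w1 \<le> w2" "w2 \<le> v" "in_branch u w1" "in_branch w1 w2" "in_branch w2 v"
proof -
  define k where "k = \<lfloor>2 * u\<rfloor>"
  have k: "of_int k \<le> 2 * u" "2 * u < of_int k + 1" unfolding k_def by linarith+
  define w1 where "w1 = min v ((of_int k + 1) / 2)"
  define w2 where "w2 = min v ((of_int k + 2) / 2)"
  have single: "in_branch x x" for x
    unfolding in_branch_def by (rule exI[of _ "\<lfloor>2 * x\<rfloor>"]) (simp add: field_simps, linarith)
  have "in_branch u w1"
    unfolding in_branch_def by (rule exI[of _ k]) (use k in \<open>auto simp: w1_def min_def\<close>)
  moreover have "in_branch w1 w2"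
  proof (cases "v \<le> (of_int k + 1) / 2")
    case False
    then show ?thesis
      unfolding in_branch_def by (intro exI[of _ "k + 1"]) (auto simp: w1_def w2_def min_def)
  qed (use single[of v] in \<open>auto simp: w1_def w2_def min_def\<close>)
  moreover have "in_branch w2 v"
  proof (cases "v \<le> (of_int k + 2) / 2")
    case False
    then show ?thesis using assms k
      unfolding in_branch_def by (intro exI[of _ "k + 2"]) (auto simp: w2_def)
  qed (use single[of v] in \<open>auto simp: w2_def min_def\<close>)
  moreover have "u \<le> w1" "w1 \<le> w2" "w2 \<le> v" using assms k by (auto simp: w1_def w2_def min_def)
  ultimately show ?thesis using that by blast
qed

lemma segment_bounds_henon:
  assumes F: "periodic2 F" "mean F = 0" and b: "segment_bounds F A B" and l: "1 \<le> l" "l \<le> \<alpha> - 1"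
  shows "segment_bounds (F \<circ> henon (tent \<alpha>)) (3 * (B + A / sqrt l)) (3 * (2 * B / sqrt l + 2 * A / l))"
proof -
  let ?G = "F \<circ> henon (tent \<alpha>)"
  have AB: "A \<ge> 0" "B \<ge> 0" using segment_bounds_nonneg[OF b] .
  have G: "periodic2 ?G" using periodic1_tent[of 1] by (intro periodic2_henon F) simp
  have *: "\<bar>line_int ?G u v y m\<bar> \<le> 3 * (B + A / sqrt l) * sqrt (v - u)"
    "\<bar>y' - y\<bar> \<le> 1 \<Longrightarrow> \<bar>line_int ?G u v y' m - line_int ?G u v y m\<bar>
      \<le> 3 * (2 * B / sqrt l + 2 * A / l) * sqrt \<bar>y' - y\<bar>"
    if uv: "u \<le> v" "v \<le> u + 1" and m: "\<bar>m\<bar> \<le> 1" for u v y y' m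
  proof -
    obtain w1 w2 where w: "u \<le> w1" "w1 \<le> w2" "w2 \<le> v" "in_branch u w1" "in_branch w1 w2" "in_branch w2 v"
      using three_branches[OF uv] .
    have J: "line_int ?G u v y m = line_int ?G u w1 y m + line_int ?G w1 w2 y m + line_int ?G w2 v y m" for y
      using line_int_combine[OF G, of u w1 v y m] line_int_combine[OF G, of w1 w2 v y m] w by simp
    note bb = branch_bounds[OF F b l m]
    have mono: "(B + A / sqrt l) * sqrt (q - p) \<le> (B + A / sqrt l) * sqrt (v - u)"
      if "u \<le> p" "p \<le> q" "q \<le> v" for p q
      using that AB l by (intro mult_left_mono) auto
    show "\<bar>line_int ?G u v y m\<bar> \<le> 3 * (B + A / sqrt l) * sqrt (v - u)"
      unfolding J using bb(1)[of u w1 y] bb(1)[of w1 w2 y] bb(1)[of w2 v y]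
        mono[of u w1] mono[of w1 w2] mono[of w2 v] w uv by linarith
    show "\<bar>line_int ?G u v y' m - line_int ?G u v y m\<bar>
      \<le> 3 * (2 * B / sqrt l + 2 * A / l) * sqrt \<bar>y' - y\<bar>" if "\<bar>y' - y\<bar> \<le> 1"
      unfolding J using bb(2)[of u w1 y' y] bb(2)[of w1 w2 y' y] bb(2)[of w2 v y' y] w uv that by linarith
  qed
  then show ?thesis by (auto simp: segment_bounds_def)
qed

lemma segment_bounds_mono:
  assumes "segment_bounds F A B" "A \<le> A'" "B \<le> B'"
  shows "segment_bounds F A' B'"
  unfolding segment_bounds_def
proof (intro conjI allI impI; elim conjE)
  fix u v y m :: real assume uv: "u \<le> v" "v \<le> u + 1" "\<bar>m\<bar> \<le> 1"
  then have "\<bar>line_int F u v y m\<bar> \<le> A * sqrt (v - u)" by (rule segment_boundsD[OF assms(1)])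
  also have "\<dots> \<le> A' * sqrt (v - u)" using uv assms by (intro mult_right_mono) auto
  finally show "\<bar>line_int F u v y m\<bar> \<le> A' * sqrt (v - u)" .
next
  fix u v y y' m :: real assume uv: "u \<le> v" "v \<le> u + 1" "\<bar>m\<bar> \<le> 1" "\<bar>y' - y\<bar> \<le> 1"
  then have "\<bar>line_int F u v y' m - line_int F u v y m\<bar> \<le> B * sqrt \<bar>y' - y\<bar>"
    by (rule segment_boundsD[OF assms(1)])
  also have "\<dots> \<le> B' * sqrt \<bar>y' - y\<bar>" using assms by (intro mult_right_mono) auto
  finally show "\<bar>line_int F u v y' m - line_int F u v y m\<bar> \<le> B' * sqrt \<bar>y' - y\<bar>" .
qed

text \<open>Since \<open>3 * B\<close> enters the new first bound without a small factor,
  \<open>B\<close> is weighted by 12, which makes this term \<open>N / 4\<close>. All other terms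
  are small for \<open>l = 10000\<close>; the condition \<open>l \<le> \<alpha> - 1\<close> gives
  the threshold 10001.\<close>

lemma segment_bounds_henon_half:
  assumes F: "periodic2 F" "mean F = 0" and b: "segment_bounds F N (N / 12)" and \<alpha>: "\<alpha> \<ge> 10001"
  shows "segment_bounds (F \<circ> henon (tent \<alpha>)) (N / 2) (N / 2 / 12)"
proof (rule segment_bounds_mono[OF segment_bounds_henon[OF F b, of 10000]])
  have s: "sqrt 10000 = (100::real)" by (rule real_sqrt_unique) auto
  have "N \<ge> 0" using segment_bounds_nonneg[OF b] by simp
  then show "3 * (N / 12 + N / sqrt 10000) \<le> N / 2"
    "3 * (2 * (N / 12) / sqrt 10000 + 2 * N / 10000) \<le> N / 2 / 12"
    unfolding s by (simp_all add: field_simps)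
qed (use \<alpha> in auto)

lemma segment_bounds_henon_funpow:
  assumes F: "periodic2 F" "mean F = 0" and b: "segment_bounds F N (N / 12)" and \<alpha>: "\<alpha> \<ge> 10001"
  shows "segment_bounds (F \<circ> henon (tent \<alpha>) ^^ n) (N / 2 ^ n) (N / 2 ^ n / 12)"
    and "periodic2 (F \<circ> henon (tent \<alpha>) ^^ n)" and "mean (F \<circ> henon (tent \<alpha>) ^^ n) = mean F"
proof -
  have t: "periodic1 (tent \<alpha>)" using periodic1_tent[of 1] by simp
  have "segment_bounds (F \<circ> henon (tent \<alpha>) ^^ n) (N / 2 ^ n) (N / 2 ^ n / 12) \<and>
    periodic2 (F \<circ> henon (tent \<alpha>) ^^ n) \<and> mean (F \<circ> henon (tent \<alpha>) ^^ n) = mean F"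
  proof (induction n)
    case (Suc n)
    let ?G = "F \<circ> henon (tent \<alpha>) ^^ n"
    have G: "segment_bounds ?G (N / 2 ^ n) (N / 2 ^ n / 12)" "periodic2 ?G" "mean ?G = 0"
      using Suc unfolding F(2) by blast+
    \<comment> \<open>The new factor is placed innermost, so that the one-step estimate applies to
      \<open>?G\<close>.\<close>
    have e: "F \<circ> henon (tent \<alpha>) ^^ Suc n = ?G \<circ> henon (tent \<alpha>)"
      by (simp only: funpow_Suc_right o_assoc)
    have N: "N / 2 ^ Suc n = N / 2 ^ n / 2" by simp
    show ?case
      unfolding e N
      by (intro conjI segment_bounds_henon_half periodic2_henon t G \<alpha>)
         (simp only: mean_henon[OF t G(2)] G(3) F(2))
  qed (use assms in auto)
  then show "segment_bounds (F \<circ> henon (tent \<alpha>) ^^ n) (N / 2 ^ n) (N / 2 ^ n / 12)"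
    "periodic2 (F \<circ> henon (tent \<alpha>) ^^ n)" "mean (F \<circ> henon (tent \<alpha>) ^^ n) = mean F" by auto
qed

section \<open>Entering and leaving the segment seminorms\<close>

text \<open>Widths and offsets are at most 1, where \<open>t \<le> sqrt t\<close>. The Lipschitz
  condition is purely vertical because a shear translates vertical lines and so keeps its constant,
  whatever the size of \<alpha>.\<close>

lemma segment_bounds_Lipschitz:
  assumes G: "periodic2 G" and bd: "\<And>z. \<bar>G z\<bar> \<le> A"
    and lip: "\<And>x y y'. \<bar>G (x, y') - G (x, y)\<bar> \<le> B * \<bar>y' - y\<bar>"
  shows "segment_bounds G A B"
proof -
  have A: "A \<ge> 0" using bd[of 0] by linarith
  have B: "B \<ge> 0" using lip[of 0 1 0] by simp
  have sq: "t \<le> sqrt t" if "0 \<le> t" "t \<le> 1" for t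
    using that by (intro real_le_rsqrt) (simp add: power2_eq_square mult_left_le)
  have c: "continuous_on S (\<lambda>x. G (x, y + m * x))" for S y m
    by (intro periodic2_continuous[OF G] continuous_intros)
  show ?thesis
    unfolding segment_bounds_def
  proof (intro conjI allI impI; elim conjE)
    fix u v y m :: real assume uv: "u \<le> v" "v \<le> u + 1"
    have "\<bar>line_int G u v y m\<bar> \<le> A * (v - u)"
      using integral_bound[OF uv(1) c] bd by (simp add: line_int_def)
    also have "\<dots> \<le> A * sqrt (v - u)" using uv A sq by (intro mult_left_mono) auto
    finally show "\<bar>line_int G u v y m\<bar> \<le> A * sqrt (v - u)" .
  next
    fix u v y y' m :: real assume uv: "u \<le> v" "v \<le> u + 1" "\<bar>y' - y\<bar> \<le> 1"
    have "line_int G u v y' m - line_int G u v y m =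
        integral {u..v} (\<lambda>x. G (x, y' + m * x) - G (x, y + m * x))"
      unfolding line_int_def
      by (intro Henstock_Kurzweil_Integration.integral_diff[symmetric] integrable_continuous_real c)
    also have "norm \<dots> \<le> B * \<bar>y' - y\<bar> * (v - u)"
    proof (rule integral_bound[OF uv(1)])
      show "norm (G (x, y' + m * x) - G (x, y + m * x)) \<le> B * \<bar>y' - y\<bar>" for x
        using lip[of x "y' + m * x" "y + m * x"] by simp
    qed (intro continuous_intros c)
    also have "\<dots> \<le> B * sqrt \<bar>y' - y\<bar> * 1"
      using uv B sq by (intro mult_mono) auto
    finally show "\<bar>line_int G u v y' m - line_int G u v y m\<bar> \<le> B * sqrt \<bar>y' - y\<bar>" by simp
  qed
qed

text \<open>On each horizontal line, integration by parts moves the derivative onto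
  \<open>f\<close>. The primitive \<open>K\<close> of \<open>G\<close> is an integral over a segment
  of slope 0, hence bounded by \<open>A\<close>.\<close>

lemma mean_mult_segment_bounds:
  assumes f: "periodic2 f" and G: "periodic2 G" and b: "segment_bounds G A B"
    and der: "\<And>x y. ((\<lambda>x. f (x, y)) has_real_derivative f' (x, y)) (at x)"
    and cont: "continuous_on UNIV f'"
    and bd: "\<And>z. \<bar>f z\<bar> \<le> M" "\<And>z. \<bar>f' z\<bar> \<le> M'"
  shows "\<bar>mean (\<lambda>z. f z * G z)\<bar> \<le> A * (M + M')"
proof -
  have A: "A \<ge> 0" using segment_bounds_nonneg[OF b] by simp
  have cfG: "continuous_on UNIV (\<lambda>z. f z * G z)"
    using f G by (auto simp: periodic2_def intro!: continuous_intros)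
  have *: "\<bar>integral {0..1} (\<lambda>x. f (x, y) * G (x, y))\<bar> \<le> A * (M + M')" for y
  proof -
    define K where "K x = integral {0..x} (\<lambda>t. G (t, y))" for x
    have cG: "continuous_on {0..1} (\<lambda>t. G (t, y))"
      by (intro periodic2_continuous[OF G] continuous_intros)
    have K: "(K has_real_derivative G (x, y)) (at x within {0..1})" if "x \<in> {0..1}" for x
      unfolding K_def using integral_has_real_derivative[OF cG that] .
    have Kb: "\<bar>K x\<bar> \<le> A" if "x \<in> {0..1}" for x
    proof -
      have "\<bar>K x\<bar> \<le> A * sqrt x"
        using segment_boundsD(1)[OF b, of 0 x 0 y] that by (simp add: K_def line_int_def)
      also have "\<dots> \<le> A * 1" using that A by (intro mult_left_mono) auto
      finally show ?thesis by simp
    qed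
    have cK: "continuous_on {0..1} K" using K by (rule DERIV_continuous_on)
    have cf': "continuous_on {0..1} (\<lambda>x. f' (x, y))"
      by (intro continuous_on_compose2[OF cont] continuous_intros) auto
    have fK: "continuous_on {0..1} (\<lambda>x. f' (x, y) * K x)" by (intro continuous_intros cK cf')
    have "((\<lambda>x. f' (x, y) * K x + f (x, y) * G (x, y)) has_integral f (1, y) * K 1 - f (0, y) * K 0) {0..1}"
    proof (rule fundamental_theorem_of_calculus)
      fix x :: real assume x: "x \<in> {0..1}"
      show "((\<lambda>x. f (x, y) * K x) has_vector_derivative f' (x, y) * K x + f (x, y) * G (x, y)) (at x within {0..1})"
        unfolding has_real_derivative_iff_has_vector_derivative[symmetric]
        using DERIV_mult[OF has_field_derivative_at_within[OF der[of y x]] K[OF x]]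
        by (simp add: algebra_simps)
    qed simp
    moreover have "K 0 = 0" by (simp add: K_def)
    ultimately have "integral {0..1} (\<lambda>x. f' (x, y) * K x + f (x, y) * G (x, y)) = f (1, y) * K 1"
      by (simp add: integral_unique)
    moreover have "integral {0..1} (\<lambda>x. f' (x, y) * K x + f (x, y) * G (x, y)) =
        integral {0..1} (\<lambda>x. f' (x, y) * K x) + integral {0..1} (\<lambda>x. f (x, y) * G (x, y))"
      by (intro Henstock_Kurzweil_Integration.integral_add integrable_continuous_real fK continuous_intros cG
            periodic2_continuous[OF f])
    moreover have "norm (integral {0..1} (\<lambda>x. f' (x, y) * K x)) \<le> M' * A * (1 - 0)"
    proof (rule integral_bound)
      fix x :: real assume "x \<in> {0..1}"
      then show "norm (f' (x, y) * K x) \<le> M' * A"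
        using bd(2)[of "(x, y)"] Kb[of x] by (simp add: abs_mult mult_mono')
    qed (use fK in auto)
    moreover have "\<bar>f (1, y) * K 1\<bar> \<le> M * A"
      using bd(1)[of "(1, y)"] Kb[of 1] by (simp add: abs_mult mult_mono')
    ultimately show ?thesis by (simp add: algebra_simps)
  qed
  have "mean (\<lambda>z. f z * G z) = integral {0..1} (\<lambda>y. integral {0..1} (\<lambda>x. f (x, y) * G (x, y)))"
    using integral_swap_real[OF cfG] by (simp add: mean_def)
  also have "norm \<dots> \<le> A * (M + M') * (1 - 0)"
  proof (rule integral_bound)
    have "continuous_on UNIV (\<lambda>z. f (snd z, fst z) * G (snd z, fst z))"
      by (intro continuous_intros periodic2_continuous[OF f] periodic2_continuous[OF G])
    then show "continuous_on {0..1} (\<lambda>y. integral {0..1} (\<lambda>x. f (x, y) * G (x, y)))"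
      using continuous_on_subset[OF continuous_on_section_integral] by fastforce
  qed (use * in auto)
  finally show ?thesis by simp
qed

section \<open>Lifting functions and the flow from the torus to the plane\<close>

lemma proj_shift: "proj (x + 1, y) = proj (x, y)" "proj (x, y + 1) = proj (x, y)"
  by (simp_all add: proj_eq_iff)

lemma proj_surj: obtains p where "z = proj p"
  by (induct z rule: torus.abs_induct) blast

lemma periodic2_lift: "continuous_on UNIV (f \<circ> proj) \<Longrightarrow> periodic2 (f \<circ> proj)"
  by (simp add: periodic2_def proj_shift)

lemma borel_measurable_torus:
  assumes "continuous_on UNIV (h \<circ> proj)"
  shows "(h :: torus \<Rightarrow> real) \<in> borel_measurable borel"
proof (rule borel_measurable_continuous_onI)
  show "continuous_on UNIV h"
    unfolding continuous_on_open_vimage[OF open_UNIV]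
    using assms by (simp add: open_torus_def continuous_on_open_vimage[OF open_UNIV] vimage_comp del: o_apply)
qed

text \<open>The pushforward gives an integral over the half-open square. The closed square differs
  from it by part of its frontier, a null set, and there the integral becomes iterated.\<close>

lemma integral_torus_measure:
  assumes c: "continuous_on UNIV (h \<circ> proj)"
  shows "(\<integral>z. h z \<partial>torus_measure) = mean (h \<circ> proj)"
proof -
  let ?S = "{0..<1::real} \<times> {0..<1::real}"
  let ?C = "cbox (0::real, 0::real) (1, 1)"
  have sq: "?S \<in> sets lborel"
    unfolding lborel_prod[symmetric] by (intro pair_measureI) auto
  have "proj \<in> borel_measurable (restrict_space lborel ?S)"
    by (intro measurable_restrict_space1) (simp add: continuous_on_proj borel_measurable_continuous_onI)
  then have "(\<integral>z. h z \<partial>torus_measure) = (\<integral>p. h (proj p) \<partial>restrict_space lborel ?S)"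
    unfolding torus_measure_def by (intro integral_distr borel_measurable_torus c)
  also have "\<dots> = (LINT p:?S|lborel. h (proj p))"
    using sq by (simp add: integral_restrict_space set_lebesgue_integral_def)
  also have "\<dots> = integral ?S (\<lambda>p. h (proj p))"
  proof (rule set_borel_integral_eq_integral)
    have "set_integrable lborel ?C (h \<circ> proj)"
      unfolding set_integrable_def
      by (rule borel_integrable_compact[OF compact_cbox continuous_on_subset[OF c subset_UNIV]])
    then have "set_integrable lborel ?S (h \<circ> proj)"
      by (rule set_integrable_subset[OF _ sq]) auto
    then show "set_integrable lborel ?S (\<lambda>p. h (proj p))" by (simp only: o_def)
  qed
  also have "\<dots> = integral ?C (\<lambda>p. h (proj p))"
  proof (rule integral_spike_set)
    have "negligible (?C - box (0, 0) (1, 1))" by (rule negligible_frontier_interval)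
    moreover have "?C - ?S \<subseteq> ?C - box (0, 0) (1, 1)" by (auto simp: box_def Basis_prod_def)
    ultimately have "negligible (?C - ?S)" by (rule negligible_subset)
    then show "negligible {x \<in> ?C - ?S. h (proj x) \<noteq> 0}" by (rule negligible_subset) auto
    have "{x \<in> ?S - ?C. h (proj x) \<noteq> 0} = {}" by auto
    then show "negligible {x \<in> ?S - ?C. h (proj x) \<noteq> 0}" by (simp only: negligible_empty)
  qed
  also have "\<dots> = mean (h \<circ> proj)"
    using integral_prod_continuous[of 0 0 1 1 "h \<circ> proj"] continuous_on_subset[OF c]
    by (simp add: mean_def o_def)
  finally show ?thesis .
qed

text \<open>Measure preservation is recorded through the action on lifts of continuous functions.
  The continuous right inverse later lifts \<open>inv (\<phi> t)\<close> and yields the continuity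
  of the integrand.\<close>

definition torus_auto :: "(real \<times> real \<Rightarrow> real \<times> real) \<Rightarrow> bool" where
  "torus_auto \<Psi> \<longleftrightarrow> (\<forall>F. periodic2 F \<longrightarrow> periodic2 (F \<circ> \<Psi>) \<and> mean (F \<circ> \<Psi>) = mean F) \<and>
     (\<exists>\<Psi>'. continuous_on UNIV \<Psi>' \<and> (\<forall>w. \<Psi> (\<Psi>' w) = w))"

lemma torus_auto_id: "torus_auto id"
  by (auto simp: torus_auto_def intro!: exI[of _ id] continuous_on_id)

lemma torus_auto_comp:
  assumes "torus_auto \<Psi>" "torus_auto \<Theta>"
  shows "torus_auto (\<Psi> \<circ> \<Theta>)"
proof -
  obtain \<Psi>' \<Theta>' where "continuous_on UNIV \<Psi>'" "\<forall>w. \<Psi> (\<Psi>' w) = w"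
    "continuous_on UNIV \<Theta>'" "\<forall>w. \<Theta> (\<Theta>' w) = w"
    using assms by (auto simp: torus_auto_def)
  then have "continuous_on UNIV (\<Theta>' \<circ> \<Psi>')" "\<forall>w. (\<Psi> \<circ> \<Theta>) ((\<Theta>' \<circ> \<Psi>') w) = w"
    using continuous_on_compose2[of UNIV \<Theta>' UNIV \<Psi>'] by (simp_all add: o_def del: split_paired_All)
  moreover have "periodic2 (F \<circ> (\<Psi> \<circ> \<Theta>)) \<and> mean (F \<circ> (\<Psi> \<circ> \<Theta>)) = mean F" if "periodic2 F" for F
    using assms that unfolding o_assoc torus_auto_def by metis
  ultimately show ?thesis unfolding torus_auto_def by blast
qed

lemma torus_auto_funpow: "torus_auto \<Psi> \<Longrightarrow> torus_auto (\<Psi> ^^ n)"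
  by (induction n) (auto intro: torus_auto_comp simp: torus_auto_id simp flip: id_def)

lemma torus_auto_swap: "torus_auto prod.swap"
  unfolding torus_auto_def
  by (intro conjI allI impI exI[of _ prod.swap])
     (auto simp: periodic2_swap mean_swap prod.swap_def intro!: continuous_intros)

lemma torus_auto_shear:
  assumes q: "periodic1 q"
  shows "torus_auto (shear q)"
proof -
  have "continuous_on UNIV (\<lambda>z::real \<times> real. q (fst z))"
    using q by (auto simp: periodic1_def intro!: continuous_on_compose2[of UNIV q] continuous_intros)
  then have "continuous_on UNIV (shear (\<lambda>x. - q x))"
    unfolding shear_def[abs_def] by (intro continuous_intros)
  moreover have "shear q (shear (\<lambda>x. - q x) w) = w" for w by (simp add: shear_def)
  ultimately show ?thesis
    unfolding torus_auto_def using periodic2_shear[OF q] mean_shear[OF q] by blast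
qed

lemma funpow_swap: "prod.swap ^^ k = (if even k then id else prod.swap)"
  by (induction k) auto

lemma norm_funpow_swap_diff:
  "norm ((prod.swap ^^ k) (x, y') - (prod.swap ^^ k) (x, y :: real)) = \<bar>y' - y\<bar>"
  for x :: real
  by (simp add: funpow_swap norm_Pair)

text \<open>A lift of the flow at time \<open>k / 2 + \<tau>\<close>: \<open>k\<close> half-periods,
  then a partial shear, and finally the swaps accumulated by \<open>henon\<close> are
  undone.\<close>

definition flow_lift :: "real \<Rightarrow> nat \<Rightarrow> real \<Rightarrow> real \<times> real \<Rightarrow> real \<times> real" where
  "flow_lift \<alpha> k \<tau> = prod.swap ^^ k \<circ> shear (\<lambda>x. 2 * \<tau> * tent \<alpha> x) \<circ> henon (tent \<alpha>) ^^ k"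

lemma torus_auto_flow_lift: "torus_auto (flow_lift \<alpha> k \<tau>)"
  unfolding flow_lift_def henon_def
  using periodic1_tent[of 1 \<alpha>]
  by (intro torus_auto_comp torus_auto_funpow torus_auto_swap torus_auto_shear periodic1_tent) simp

lemma u_field_half_integer:
  "u_field \<alpha> (real k / 2) = (if even k then V_field \<alpha> else H_field \<alpha>)"
proof -
  have "frac (real k / 2) = (if even k then 0 else 1/2)"
  proof (cases "even k")
    case True
    then obtain m where "k = 2 * m" by blast
    then show ?thesis using True by simp
  next
    case False
    then obtain m where m: "k = 2 * m + 1" by (elim oddE)
    have "frac (real k / 2) = 1/2"
      using m by (intro frac_unique_iff[THEN iffD2]) (auto simp: field_simps)
    with False show ?thesis by simp
  qed
  then show ?thesis by (simp add: u_field_def)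
qed

lemma flow_lift_step:
  "translate (proj ((prod.swap ^^ k) q)) (\<tau> *\<^sub>R u_field \<alpha> (real k / 2) (proj ((prod.swap ^^ k) q))) =
    proj ((prod.swap ^^ k) (shear (\<lambda>x. 2 * \<tau> * tent \<alpha> x) q))"
  by (cases q) (simp add: funpow_swap u_field_half_integer translate.abs_eq V_field.abs_eq H_field.abs_eq
      shear_def tent_def algebra_simps)

lemma flow_map_flow_lift:
  assumes \<phi>: "is_flow_map (u_field \<alpha>) \<phi>" and \<tau>: "0 \<le> \<tau>" "\<tau> \<le> 1/2"
  shows "\<phi> (real k / 2 + \<tau>) (proj w) = proj (flow_lift \<alpha> k \<tau> w)"
proof -
  have step: "\<phi> (real k / 2 + \<tau>) (proj w) = proj (flow_lift \<alpha> k \<tau> w)"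
    if "\<phi> (real k / 2) (proj w) = proj ((prod.swap ^^ k) ((henon (tent \<alpha>) ^^ k) w))" "0 \<le> \<tau>" "\<tau> \<le> 1/2"
    for k \<tau>
    using flow_map_step[OF \<phi>, of k "real k / 2 + \<tau>" "proj w"] that flow_lift_step
    by (simp add: flow_lift_def)
  have "\<phi> (real k / 2) (proj w) = proj ((prod.swap ^^ k) ((henon (tent \<alpha>) ^^ k) w))" for k
  proof (induction k)
    case 0
    then show ?case using \<phi> by (simp add: is_flow_map_def)
  next
    case (Suc k)
    \<comment> \<open>At \<tau> = 1/2 the shear is by the tent itself; inserting two cancelling
      swaps completes it to one more \<open>henon\<close>.\<close>
    have "flow_lift \<alpha> k (1/2) w = (prod.swap ^^ Suc k) ((henon (tent \<alpha>) ^^ Suc k) w)"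
      unfolding flow_lift_def funpow_swap by (simp add: henon_def)
    moreover have "real k / 2 + 1/2 = real (Suc k) / 2" by (simp add: field_simps)
    moreover have "\<phi> (real k / 2 + 1/2) (proj w) = proj (flow_lift \<alpha> k (1/2) w)"
      by (rule step[OF Suc]) auto
    ultimately show ?case by metis
  qed
  then show ?thesis using step \<tau> by blast
qed

section \<open>The norm on continuously differentiable functions\<close>

lemma periodic2_bounded:
  assumes F: "periodic2 F"
  shows "\<exists>M. \<forall>z. \<bar>F z\<bar> \<le> M"
proof -
  have "continuous_on (cbox (0, 0) (1, 1)) F"
    using F continuous_on_subset by (auto simp: periodic2_def)
  then have "bounded (F ` cbox (0, 0) (1, 1))"
    by (intro compact_imp_bounded compact_continuous_image compact_cbox)
  then obtain M where M: "\<And>z. z \<in> cbox (0, 0) (1, 1) \<Longrightarrow> \<bar>F z\<bar> \<le> M"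
    by (force simp: bounded_iff)
  have "\<bar>F (x, y)\<bar> \<le> M" for x y
  proof -
    interpret a: periodic_fun_simple' "\<lambda>x. F (x, frac y)"
      by standard (simp add: periodic2_fst[OF F])
    interpret b: periodic_fun_simple' "\<lambda>y. F (x, y)"
      by standard (simp add: periodic2_snd[OF F])
    have "F (frac x, frac y) = F (x, y)"
      using a.minus_of_int[of x "\<lfloor>x\<rfloor>"] b.minus_of_int[of y "\<lfloor>y\<rfloor>"] by (simp add: frac_def)
    moreover have "(frac x, frac y) \<in> cbox (0, 0) (1, 1)"
      by (simp add: less_imp_le[OF frac_lt_1])
    ultimately show ?thesis using M by metis
  qed
  then show ?thesis by auto
qed

text \<open>The suprema in \<open>C1_norm\<close> are meaningful only for bounded sets. Boundedness
  holds because the derivative of the lift is again periodic: its two partial derivatives are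
  bounded on a unit cell and together control the operator norm.\<close>

lemma C1_torus_bounds:
  assumes f: "C1_torus f"
  obtains M M' where "C1_norm f = M + M'" "\<And>z. \<bar>f z\<bar> \<le> M"
    "\<And>p. onorm (frechet_derivative (f \<circ> proj) (at p)) \<le> M'"
proof -
  define F where "F = f \<circ> proj"
  define D where "D p = frechet_derivative F (at p)" for p
  have dF: "(F has_derivative D p) (at p)" for p
    using f unfolding D_def F_def frechet_derivative_works[symmetric] C1_torus_def by blast
  then have F: "periodic2 F"
    unfolding F_def
    by (intro periodic2_lift continuous_at_imp_continuous_on)
       (auto intro: has_derivative_continuous)
  have shift: "D (p + e) = D p" if "\<And>q. F (q + e) = F q" for p e
  proof -
    have "((\<lambda>q. F (q + e)) has_derivative D (p + e)) (at p)"
      by (rule has_derivative_compose[of "\<lambda>q. q + e" "\<lambda>h. h", OF _ dF]) (auto intro!: derivative_eq_intros)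
    then show ?thesis
      unfolding D_def[of p] using that by (intro frechet_derivative_at) simp
  qed
  have "D (p + (1, 0)) = D p" "D (p + (0, 1)) = D p" for p
    by (rule shift, use periodic2_fst[OF F] periodic2_snd[OF F] in \<open>auto simp: split_paired_all\<close>)+
  then have D: "D (x + 1, y) = D (x, y)" "D (x, y + 1) = D (x, y)" for x y
    by (metis add_Pair add.right_neutral)+
  have Dp: "periodic2 (\<lambda>p. D p v)" for v
    using f D by (simp add: periodic2_def C1_torus_def D_def F_def del: split_paired_All)
  obtain K where K: "\<And>z. \<bar>F z\<bar> \<le> K" using periodic2_bounded[OF F] by blast
  obtain K1 K2 where K12: "\<And>p. \<bar>D p (1, 0)\<bar> \<le> K1" "\<And>p. \<bar>D p (0, 1)\<bar> \<le> K2"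
    using periodic2_bounded[OF Dp] by meson
  have on: "onorm (D p) \<le> K1 + K2" for p
  proof (rule onorm_bound)
    show "0 \<le> K1 + K2" using K12[of p] by linarith
    fix v :: "real \<times> real"
    interpret bounded_linear "D p" using dF by (rule has_derivative_bounded_linear)
    have "v = fst v *\<^sub>R (1, 0) + snd v *\<^sub>R (0, 1)" by (cases v) simp
    then have "D p v = fst v * D p (1, 0) + snd v * D p (0, 1)"
      by (metis add scale real_scaleR_def)
    then have "\<bar>D p v\<bar> \<le> \<bar>fst v\<bar> * \<bar>D p (1, 0)\<bar> + \<bar>snd v\<bar> * \<bar>D p (0, 1)\<bar>"
      by (metis abs_mult abs_triangle_ineq)
    also have "\<dots> \<le> norm v * K1 + norm v * K2"
      using K12[of p] norm_fst_le[of "fst v" "snd v"] norm_snd_le[of "snd v" "fst v"]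
      by (intro add_mono mult_mono) auto
    finally show "norm (D p v) \<le> (K1 + K2) * norm v" by (simp add: algebra_simps)
  qed
  show ?thesis
  proof (rule that)
    show "C1_norm f = (SUP z. \<bar>f z\<bar>) + (SUP p. onorm (frechet_derivative (f \<circ> proj) (at p)))"
      by (simp add: C1_norm_def)
    show "\<bar>f z\<bar> \<le> (SUP z. \<bar>f z\<bar>)" for z
    proof (rule cSUP_upper)
      have "\<bar>f z\<bar> \<le> K" for z using K by (metis F_def comp_apply proj_surj)
      then show "bdd_above (range (\<lambda>z. \<bar>f z\<bar>))" by (rule bdd_aboveI2)
    qed simp
    show "onorm (frechet_derivative (f \<circ> proj) (at p)) \<le> (SUP p. onorm (frechet_derivative (f \<circ> proj) (at p)))" for p
      using on by (intro cSUP_upper bdd_aboveI2[of _ _ "K1 + K2"]) (auto simp: D_def F_def)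
  qed
qed

section \<open>Decay of correlations along the flow\<close>

text \<open>Invariance of the mean transfers the flow from \<open>f\<close> to \<open>g\<close>. The
  composed function, minus its mean, is a function with controlled seminorms followed by
  \<open>k\<close> powers of \<open>henon\<close>; these halve the bounds \<open>k\<close> times,
  and pairing with \<open>f\<close> concludes.\<close>

lemma flow_correlation_decay:
  assumes \<phi>: "is_flow_map (u_field \<alpha>) \<phi>" and \<alpha>: "\<alpha> \<ge> 10001" and \<tau>: "0 \<le> \<tau>" "\<tau> \<le> 1/2"
    and f: "C1_torus f" and g: "C1_torus g"
  shows "\<bar>(\<integral>z. f (inv (\<phi> (real k / 2 + \<tau>)) z) * g z \<partial>torus_measure)
           - (\<integral>z. f z \<partial>torus_measure) * (\<integral>z. g z \<partial>torus_measure)\<bar>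
         \<le> 12 / 2 ^ k * C1_norm f * C1_norm g"
proof -
  define t where "t = real k / 2 + \<tau>"
  define f1 where "f1 = f \<circ> proj"
  define g1 where "g1 = g \<circ> proj"
  define \<Psi> where "\<Psi> = flow_lift \<alpha> k \<tau>"
  have C1_diff: "(h \<circ> proj has_derivative frechet_derivative (h \<circ> proj) (at p)) (at p)"
    if "C1_torus h" for h p
    using that unfolding C1_torus_def frechet_derivative_works[symmetric] by blast
  have C1_cont: "continuous_on UNIV (h \<circ> proj)" if "C1_torus h" for h
    by (intro continuous_at_imp_continuous_on ballI has_derivative_continuous[OF C1_diff[OF that]])
  have f1: "periodic2 f1" and g1: "periodic2 g1"
    unfolding f1_def g1_def by (intro periodic2_lift C1_cont f g)+
  obtain M M' where M: "C1_norm f = M + M'" "\<And>z. \<bar>f z\<bar> \<le> M"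
    "\<And>p. onorm (frechet_derivative (f \<circ> proj) (at p)) \<le> M'"
    using C1_torus_bounds[OF f] by blast
  obtain N N' where N: "C1_norm g = N + N'" "\<And>z. \<bar>g z\<bar> \<le> N"
    "\<And>p. onorm (frechet_derivative (g \<circ> proj) (at p)) \<le> N'"
    using C1_torus_bounds[OF g] by blast
  have N0: "N \<ge> 0" using N(2)[of undefined] by linarith
  have N'0: "N' \<ge> 0"
    using onorm_pos_le[OF has_derivative_bounded_linear[OF C1_diff[OF g, of 0]]] N(3)[of 0] by linarith
  have lip: "\<bar>g1 p - g1 q\<bar> \<le> N' * norm (p - q)" for p q
    using differentiable_bound[of UNIV g1 "\<lambda>p. frechet_derivative g1 (at p)" N' p q]
      C1_diff[OF g] N(3) by (simp add: g1_def)

  have aut_\<Psi>: "torus_auto \<Psi>" unfolding \<Psi>_def by (rule torus_auto_flow_lift)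
  obtain \<Psi>' where \<Psi>': "continuous_on UNIV \<Psi>'" "\<And>w. \<Psi> (\<Psi>' w) = w"
    using aut_\<Psi> by (auto simp: torus_auto_def simp del: split_paired_All)
  have lift: "\<phi> t (proj w) = proj (\<Psi> w)" for w
    unfolding t_def \<Psi>_def by (rule flow_map_flow_lift[OF \<phi> \<tau>])
  have "t \<ge> 0" using \<tau> by (simp add: t_def)
  then have inj: "inj (\<phi> t)" using flow_map_bij[OF \<phi>] bij_is_inj by blast
  have inv: "inv (\<phi> t) (proj w) = proj (\<Psi>' w)" for w
    by (rule inv_f_eq[OF inj]) (simp add: lift \<Psi>')
  define h where "h z = f (inv (\<phi> t) z) * g z" for z
  have h: "h \<circ> proj = (\<lambda>w. f1 (\<Psi>' w) * g1 w)"
    by (auto simp: h_def inv f1_def g1_def)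
  have hc: "continuous_on UNIV (h \<circ> proj)"
    unfolding h using f1 g1 \<Psi>'(1)
    by (intro continuous_intros continuous_on_compose2[of UNIV f1 UNIV \<Psi>']) (auto simp: periodic2_def)
  \<comment> \<open>This is the change of variables: composing with \<open>\<Psi>\<close> cancels
    the inverse flow in the factor \<open>f\<close>.\<close>
  have "mean (h \<circ> proj) = mean (h \<circ> proj \<circ> \<Psi>)"
    using aut_\<Psi> periodic2_lift[OF hc] unfolding torus_auto_def by metis
  moreover have "h (proj (\<Psi> w)) = f1 w * g1 (\<Psi> w)" for w
    using inv_f_f[OF inj, of "proj w"] by (simp add: h_def f1_def g1_def flip: lift)
  ultimately have int_h: "(\<integral>z. h z \<partial>torus_measure) = mean (\<lambda>w. f1 w * g1 (\<Psi> w))"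
    using integral_torus_measure[OF hc] by (simp add: o_def)

  \<comment> \<open>The outer swaps and the incomplete last half-period are absorbed into the
    observable, leaving a pure power of \<open>henon\<close>.\<close>
  define G where "G = g1 \<circ> (prod.swap ^^ k \<circ> shear (\<lambda>x. 2 * \<tau> * tent \<alpha> x))"
  have aut: "torus_auto (prod.swap ^^ k \<circ> shear (\<lambda>x. 2 * \<tau> * tent \<alpha> x))"
    by (intro torus_auto_comp torus_auto_funpow torus_auto_swap torus_auto_shear periodic1_tent)
  have G: "periodic2 G" "mean G = mean g1"
    using aut g1 unfolding G_def torus_auto_def by blast+
  define F where "F z = G z - mean g1" for z
  have F: "periodic2 F" "mean F = 0"
    using G mean_diff_const[OF G(1), of "mean g1"]
    by (auto simp: F_def[abs_def] periodic2_def intro!: continuous_intros)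
  have "segment_bounds F (2 * N) N'"
  proof (rule segment_bounds_Lipschitz[OF F(1)])
    have gN: "\<bar>g1 z\<bar> \<le> N" for z using N(2) by (simp add: g1_def)
    have "\<bar>mean g1\<bar> \<le> N"
    proof -
      have cg: "continuous_on UNIV g1" using g1 by (simp add: periodic2_def)
      have "norm (integral {0..1} (\<lambda>y. g1 (x, y))) \<le> N * (1 - 0)" for x
        using gN by (intro integral_bound periodic2_continuous[OF g1] continuous_intros) auto
      then have "norm (mean g1) \<le> N * (1 - 0)"
        unfolding mean_def
        by (intro integral_bound continuous_on_subset[OF continuous_on_section_integral[OF cg]]) auto
      then show ?thesis by simp
    qed
    then show "\<bar>F z\<bar> \<le> 2 * N" for z
      using gN[of "((prod.swap ^^ k) \<circ> shear (\<lambda>x. 2 * \<tau> * tent \<alpha> x)) z"]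
      unfolding F_def G_def by (simp only: o_apply)
    show "\<bar>F (x, y') - F (x, y)\<bar> \<le> N' * \<bar>y' - y\<bar>" for x y y'
    proof -
      let ?q = "2 * \<tau> * tent \<alpha> x"
      have "F (x, y') - F (x, y) =
          g1 ((prod.swap ^^ k) (x, y' + ?q)) - g1 ((prod.swap ^^ k) (x, y + ?q))"
        by (simp add: F_def G_def shear_def)
      then show ?thesis
        using lip[of "(prod.swap ^^ k) (x, y' + ?q)" "(prod.swap ^^ k) (x, y + ?q)"]
        unfolding norm_funpow_swap_diff by simp
    qed
  qed
  \<comment> \<open>One number must dominate both \<open>2 * N\<close> and \<open>12 * N'\<close>;
    12 times the norm \<open>N + N'\<close> does.\<close>
  then have "segment_bounds F (12 * C1_norm g) (12 * C1_norm g / 12)"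
    by (rule segment_bounds_mono) (use N(1) N0 N'0 in auto)
  note Fk = segment_bounds_henon_funpow[OF F this \<alpha>, of k]
  define Fk where "Fk = F \<circ> henon (tent \<alpha>) ^^ k"
  have "\<bar>mean (\<lambda>w. f1 w * Fk w)\<bar> \<le> 12 * C1_norm g / 2 ^ k * (M + M')"
  proof (rule mean_mult_segment_bounds[OF f1 _ Fk(1)[folded Fk_def]])
    show "periodic2 Fk" using Fk(2) by (simp only: Fk_def)
    define D where "D z = frechet_derivative f1 (at z) (1, 0)" for z
    show "((\<lambda>x. f1 (x, y)) has_real_derivative D (x, y)) (at x)" for x y
    proof -
      let ?D = "frechet_derivative f1 (at (x, y))"
      have d: "(f1 has_derivative ?D) (at (x, y))" using C1_diff[OF f] by (simp add: f1_def)
      have "((\<lambda>x. f1 (x, y)) has_derivative (\<lambda>h. ?D (h, 0))) (at x)"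
        by (rule has_derivative_compose[of "\<lambda>x. (x, y)" "\<lambda>h. (h, 0)", OF _ d])
           (auto intro!: derivative_eq_intros)
      moreover have "?D (h, 0) = D (x, y) * h" for h
        using linear_scale[OF has_derivative_linear[OF d], of h "(1, 0)"] by (simp add: D_def)
      ultimately show ?thesis by (simp add: has_field_derivative_def mult_commute_abs)
    qed
    show "continuous_on UNIV D" using f by (simp add: D_def[abs_def] C1_torus_def f1_def)
    show "\<bar>f1 z\<bar> \<le> M" for z using M(2) by (simp add: f1_def)
    show "\<bar>D z\<bar> \<le> M'" for z
    proof -
      have "norm (D z) \<le> onorm (frechet_derivative f1 (at z)) * norm (1::real, 0::real)"
        unfolding D_def f1_def
        by (intro onorm has_derivative_bounded_linear[OF C1_diff[OF f]])
      then show ?thesis using M(3)[of z] by (simp add: f1_def norm_Pair)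
    qed
  qed
  moreover have "mean (\<lambda>w. f1 w * g1 (\<Psi> w)) = mean (\<lambda>w. f1 w * Fk w) + mean g1 * mean f1"
  proof -
    have "f1 w * g1 (\<Psi> w) = f1 w * Fk w + mean g1 * f1 w" for w
      by (simp add: Fk_def F_def G_def \<Psi>_def flow_lift_def algebra_simps)
    moreover have "periodic2 (\<lambda>w. f1 w * Fk w)"
      using f1 Fk(2)[folded Fk_def] by (auto simp: periodic2_def intro!: continuous_intros)
    ultimately show ?thesis using mean_add_mult[OF _ f1] by simp
  qed
  moreover have "(\<integral>z. f z \<partial>torus_measure) = mean f1" "(\<integral>z. g z \<partial>torus_measure) = mean g1"
    unfolding f1_def g1_def by (intro integral_torus_measure C1_cont f g)+
  ultimately have "\<bar>(\<integral>z. h z \<partial>torus_measure)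
      - (\<integral>z. f z \<partial>torus_measure) * (\<integral>z. g z \<partial>torus_measure)\<bar> \<le> 12 * C1_norm g / 2 ^ k * C1_norm f"
    unfolding int_h M(1) by (simp add: mult.commute)
  then show ?thesis unfolding h_def t_def by (simp add: mult_ac)
qed

theorem theorem2:
  shows "\<exists>\<alpha>\<^sub>0::real. \<alpha>\<^sub>0 > 0 \<and> (\<forall>\<alpha>::int. even \<alpha> \<and> real_of_int \<alpha> \<ge> \<alpha>\<^sub>0 \<longrightarrow>
    (\<forall>\<phi>. is_flow_map (u_field (real_of_int \<alpha>)) \<phi> \<longrightarrow>
      (\<exists>C c::real. C > 0 \<and> c > 0 \<and>
        (\<forall>f g t. C1_torus f \<and> C1_torus g \<and> t \<ge> 0 \<longrightarrow>
          \<bar>(\<integral>z. f (inv (\<phi> t) z) * g z \<partial>torus_measure)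
             - (\<integral>z. f z \<partial>torus_measure) * (\<integral>z. g z \<partial>torus_measure)\<bar>
          \<le> C * exp (- c * t) * C1_norm f * C1_norm g))))"
proof (rule exI[of _ 10001], intro conjI allI impI)
  fix \<alpha> :: int and \<phi>
  assume \<alpha>: "even \<alpha> \<and> 10001 \<le> real_of_int \<alpha>" and \<phi>: "is_flow_map (u_field (real_of_int \<alpha>)) \<phi>"
  show "\<exists>C c::real. C > 0 \<and> c > 0 \<and>
        (\<forall>f g t. C1_torus f \<and> C1_torus g \<and> t \<ge> 0 \<longrightarrow>
          \<bar>(\<integral>z. f (inv (\<phi> t) z) * g z \<partial>torus_measure)
             - (\<integral>z. f z \<partial>torus_measure) * (\<integral>z. g z \<partial>torus_measure)\<bar>
          \<le> C * exp (- c * t) * C1_norm f * C1_norm g)"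
  \<comment> \<open>The constants come from \<open>12 / 2 ^ k = 24 / 2 ^ (k + 1)\<close> together
    with \<open>2 * t < k + 1\<close>.\<close>
  proof (rule exI[of _ 24], rule exI[of _ "2 * ln 2"], intro conjI allI impI; (elim conjE)?)
    fix f g and t :: real
    assume f: "C1_torus f" and g: "C1_torus g" and t: "0 \<le> t"
    obtain k where k: "real k / 2 \<le> t" "t < real k / 2 + 1/2"
      using half_interval_cover[OF t] .
    define \<tau> where "\<tau> = t - real k / 2"
    have \<tau>: "0 \<le> \<tau>" "\<tau> \<le> 1/2" and t_eq: "t = real k / 2 + \<tau>" using k by (auto simp: \<tau>_def)
    have norm_nonneg: "C1_norm h \<ge> 0" if h: "C1_torus h" for h
    proof -
      obtain M M' where M: "C1_norm h = M + M'" "\<And>z. \<bar>h z\<bar> \<le> M"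
        "\<And>p. onorm (frechet_derivative (h \<circ> proj) (at p)) \<le> M'"
        using C1_torus_bounds[OF h] by blast
      have "bounded_linear (frechet_derivative (h \<circ> proj) (at 0))"
        using h unfolding C1_torus_def frechet_derivative_works
        by (blast intro: has_derivative_bounded_linear)
      then show ?thesis
        using M(1) M(2)[of undefined] M(3)[of 0] onorm_pos_le[of "frechet_derivative (h \<circ> proj) (at 0)"]
        by linarith
    qed
    have e: "exp (real (Suc k) * ln 2) = (2::real) ^ Suc k"
      unfolding exp_of_nat_mult by (subst exp_ln) auto
    have "12 / 2 ^ k = 24 * inverse ((2::real) ^ Suc k)" by (simp add: field_simps)
    also have "\<dots> = 24 * exp (- (real (Suc k) * ln 2))" unfolding exp_minus e ..
    also have "\<dots> \<le> 24 * exp (- (2 * ln 2) * t)"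
    proof -
      have "2 * t * ln 2 \<le> real (Suc k) * ln 2" using k by (intro mult_right_mono) auto
      then show ?thesis by (simp add: algebra_simps)
    qed
    finally have le: "12 / 2 ^ k \<le> 24 * exp (- (2 * ln 2) * t)" .
    have "\<bar>(\<integral>z. f (inv (\<phi> t) z) * g z \<partial>torus_measure)
        - (\<integral>z. f z \<partial>torus_measure) * (\<integral>z. g z \<partial>torus_measure)\<bar>
        \<le> 12 / 2 ^ k * C1_norm f * C1_norm g"
      unfolding t_eq using \<alpha> by (intro flow_correlation_decay[OF \<phi> _ \<tau> f g]) simp
    also have "\<dots> \<le> 24 * exp (- (2 * ln 2) * t) * C1_norm f * C1_norm g"
      by (intro mult_right_mono le norm_nonneg f g)
    finally show "\<bar>(\<integral>z. f (inv (\<phi> t) z) * g z \<partial>torus_measure)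
        - (\<integral>z. f z \<partial>torus_measure) * (\<integral>z. g z \<partial>torus_measure)\<bar>
        \<le> 24 * exp (- (2 * ln 2) * t) * C1_norm f * C1_norm g" .
  qed auto
qed auto

end
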